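(* Let $\Lambda\ge 3$ be an integer and let $(G,s,t)$ be a 2-terminal graph belonging to the class $\mathcal W$. If $G$ has maxmaxflow at most $\Lambda$, then every root $q\in\mathbb{C}$ of the chromatic polynomial $P_G(q)$ satisfies $|q-1| < (\Lambda-\log 2)/\log 2$.
   Context: Graphs are finite and undirected. For a graph $G=(V,E)$ the chromatic polynomial is $P_G(q)=\sum_{A\subseteq E} q^{k(A)}(-1)^{|A|}$, where $k(A)$ is the number of connected components of $(V,A)$. For distinct vertices $x,y$, $\lambda_G(x,y)$ is the maximum number of pairwise edge-disjoint $x$–$y$ paths, and the maxmaxflow is $\Lambda(G)=\max_{x\ne y}\lambda_G(x,y)$. A 2-terminal graph $(G,s,t)$ is a graph with two distinct distinguished vertices $s,t$ (the terminals). For 2-terminal graphs $(G_1,s_1,t_1),(G_2,s_2,t_2)$ on disjoint vertex sets, the parallel composition is obtained from $G_1\cup G_2$ by identifying $s_2$ with $s_1$ and $t_2$ with $t_1$, with terminals $s_1,t_1$; the series composition is obtained from $G_1\cup G_2$ by identifying $t_1$ with $s_2$, with terminals $s_1,t_2$. The Wheatstone bridge is the 2-terminal graph $(W,s,t)$ where $W=K_4$ minus one edge and $s,t$ are the two vertices of degree 2. The class $\mathcal W$ is the smallest class of 2-terminal graphs (up to isomorphism) that contains $K_2$ (with its two vertices as terminals) and the Wheatstone bridge and is closed under series and parallel composition. *)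

theory Defs
  imports Complex_Main
begin

text \<open>Finite undirected multigraphs (parallel edges allowed, as produced by parallel
composition) with two distinguished terminals. Vertices and edge labels are natural
numbers; edge e joins the two vertices of inc e.\<close>

record tgraph =
  verts :: "nat set"
  edges :: "nat set"
  inc   :: "nat \<Rightarrow> nat set"
  src   :: nat
  tgt   :: nat

definition wf_tgraph :: "tgraph \<Rightarrow> bool" where
  "wf_tgraph G \<longleftrightarrow> finite (verts G) \<and> finite (edges G) \<and>
     (\<forall>e\<in>edges G. inc G e \<subseteq> verts G \<and> card (inc G e) = 2) \<and>
     src G \<in> verts G \<and> tgt G \<in> verts G \<and> src G \<noteq> tgt G"

definition tg_iso :: "tgraph \<Rightarrow> tgraph \<Rightarrow> bool" where
  "tg_iso G H \<longleftrightarrow> (\<exists>f g. bij_betw f (verts G) (verts H) \<and> bij_betw g (edges G) (edges H) \<and>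
     (\<forall>e\<in>edges G. inc H (g e) = f ` inc G e) \<and> f (src G) = src H \<and> f (tgt G) = tgt H)"

definition K2 :: tgraph where
  "K2 = \<lparr>verts = {0,1}, edges = {0}, inc = (\<lambda>_. {0,1}), src = 0, tgt = 1\<rparr>"

text \<open>Wheatstone bridge: K4 minus the edge {0,1}; terminals 0,1 (the degree-2 vertices).\<close>
definition wheatstone :: tgraph where
  "wheatstone = \<lparr>verts = {0,1,2,3}, edges = {0,1,2,3,4},
     inc = (\<lambda>e. if e = 0 then {0,2} else if e = 1 then {0,3} else if e = 2 then {1,2}
                else if e = 3 then {1,3} else {2,3}), src = 0, tgt = 1\<rparr>"

text \<open>Compositions, for inputs with disjoint vertex sets and disjoint edge sets.\<close>
definition par_comp :: "tgraph \<Rightarrow> tgraph \<Rightarrow> tgraph" where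
  "par_comp G1 G2 = (let r = (\<lambda>x. if x = src G2 then src G1 else if x = tgt G2 then tgt G1 else x) in
     \<lparr>verts = verts G1 \<union> r ` verts G2, edges = edges G1 \<union> edges G2,
      inc = (\<lambda>e. if e \<in> edges G1 then inc G1 e else r ` inc G2 e),
      src = src G1, tgt = tgt G1\<rparr>)"

definition ser_comp :: "tgraph \<Rightarrow> tgraph \<Rightarrow> tgraph" where
  "ser_comp G1 G2 = (let r = (\<lambda>x. if x = src G2 then tgt G1 else x) in
     \<lparr>verts = verts G1 \<union> r ` verts G2, edges = edges G1 \<union> edges G2,
      inc = (\<lambda>e. if e \<in> edges G1 then inc G1 e else r ` inc G2 e),
      src = src G1, tgt = tgt G2\<rparr>)"

inductive_set classW :: "tgraph set" where
  K2: "K2 \<in> classW"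
| wheat: "wheatstone \<in> classW"
| iso: "G \<in> classW \<Longrightarrow> tg_iso G H \<Longrightarrow> H \<in> classW"
| par: "G1 \<in> classW \<Longrightarrow> G2 \<in> classW \<Longrightarrow> verts G1 \<inter> verts G2 = {} \<Longrightarrow>
        edges G1 \<inter> edges G2 = {} \<Longrightarrow> par_comp G1 G2 \<in> classW"
| ser: "G1 \<in> classW \<Longrightarrow> G2 \<in> classW \<Longrightarrow> verts G1 \<inter> verts G2 = {} \<Longrightarrow>
        edges G1 \<inter> edges G2 = {} \<Longrightarrow> ser_comp G1 G2 \<in> classW"

definition adj_rel :: "tgraph \<Rightarrow> nat set \<Rightarrow> (nat \<times> nat) set" where
  "adj_rel G A = {(x,y). \<exists>e\<in>A. inc G e = {x,y}}"

definition conn_rel :: "tgraph \<Rightarrow> nat set \<Rightarrow> (nat \<times> nat) set" where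
  "conn_rel G A = {(x,y). x \<in> verts G \<and> y \<in> verts G \<and> (x,y) \<in> (adj_rel G A)\<^sup>*}"

definition num_comp :: "tgraph \<Rightarrow> nat set \<Rightarrow> nat" where
  "num_comp G A = card (verts G // conn_rel G A)"

definition chrom_poly :: "tgraph \<Rightarrow> complex \<Rightarrow> complex" where
  "chrom_poly G q = (\<Sum>A\<in>Pow (edges G). q ^ num_comp G A * (-1) ^ card A)"

definition is_path :: "tgraph \<Rightarrow> nat \<Rightarrow> nat \<Rightarrow> nat list \<Rightarrow> nat list \<Rightarrow> bool" where
  "is_path G x y vs es \<longleftrightarrow> length vs = length es + 1 \<and> hd vs = x \<and> last vs = y \<and>
     distinct vs \<and> set vs \<subseteq> verts G \<and> set es \<subseteq> edges G \<and>
     (\<forall>i < length es. inc G (es ! i) = {vs ! i, vs ! Suc i})"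

definition path_edge_sets :: "tgraph \<Rightarrow> nat \<Rightarrow> nat \<Rightarrow> nat set set" where
  "path_edge_sets G x y = {set es | vs es. is_path G x y vs es}"

text \<open>lambda(x,y) for x \<noteq> y: maximum size of a family of pairwise edge-disjoint x-y paths
(for x \<noteq> y distinct edge-disjoint paths have distinct nonempty edge sets).\<close>
definition local_edge_conn :: "tgraph \<Rightarrow> nat \<Rightarrow> nat \<Rightarrow> nat" where
  "local_edge_conn G x y = Max {card F | F. F \<subseteq> path_edge_sets G x y \<and> pairwise disjnt F}"

definition maxmaxflow :: "tgraph \<Rightarrow> nat" where
  "maxmaxflow G = Max {local_edge_conn G x y | x y. x \<in> verts G \<and> y \<in> verts G \<and> x \<noteq> y}"

end

theory Submission
  imports Defs "HOL-Analysis.Harmonic_Numbers"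
begin

text \<open>Write \<open>Q = q - 1\<close>, \<open>R = \<bar>Q\<bar>\<close>, and let the transmissivity \<open>t\<close> of a 2-terminal graph be the
  part of its chromatic polynomial coming from the edge sets that connect the terminals, divided
  by the whole polynomial. Transmissivities multiply in series; in parallel \<open>t\<close> and \<open>u\<close>
  combine to \<open>(t + u + (Q - 1) t u) / (1 + Q t u)\<close>, and the polynomial of the parallel composition
  vanishes only if the denominator does. If \<open>k\<close> edge-disjoint paths join the terminals
  and the graph has something connected in parallel to it, then \<open>t\<close> is either \<open>- 1 / Q\<close>, the value of
  an edge, which is absorbing in parallel, or lies in the disc of radius
  \<open>(g ^ k - 1) / (R - g ^ k)\<close>. Here \<open>g\<close> is chosen such that the disc for \<open>k = 2\<close> just contains
  the Wheatstone bridge, \<open>t = 2 / (Q (Q - 1))\<close>. Since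
  \<open>k < L\<close>, all these discs have radius at most \<open>1 / R\<close> when \<open>R\<close> is outside the claimed bound;
  hence products of transmissivities are at most \<open>1 / R\<^sup>2\<close>, which is within
  the disc for \<open>k = 1\<close>, and the denominators never vanish.\<close>

section \<open>Counting components\<close>

text \<open>Taken for a bare relation, so that intermediate relations that are not the adjacency of
  any \<open>tgraph\<close> can be counted too.\<close>

definition num_classes :: "'a set \<Rightarrow> ('a \<times> 'a) set \<Rightarrow> nat" where
  "num_classes V R = card ((\<lambda>x. {y \<in> V. (x, y) \<in> R\<^sup>*}) ` V)"

lemma num_comp_eq_num_classes: "num_comp G A = num_classes (verts G) (adj_rel G A)"
proof -
  have "verts G // conn_rel G A = (\<lambda>x. {y \<in> verts G. (x, y) \<in> (adj_rel G A)\<^sup>*}) ` verts G"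
    by (auto simp: quotient_def conn_rel_def image_def)
  then show ?thesis by (simp add: num_comp_def num_classes_def)
qed

text \<open>Each label determines its class, so labels and classes correspond. Gluing and merging
  can then be expressed as changes of labels.\<close>

lemma num_classes_eq_card_labels:
  assumes "\<And>x y. x \<in> V \<Longrightarrow> y \<in> V \<Longrightarrow> (x, y) \<in> R\<^sup>* \<longleftrightarrow> lab x = lab y"
  shows "num_classes V R = card (lab ` V)"
proof -
  have "(\<lambda>x. {y \<in> V. (x, y) \<in> R\<^sup>*}) ` V = (\<lambda>l. {y \<in> V. l = lab y}) ` (lab ` V)"
    using assms by (auto simp: image_image intro!: image_cong)
  moreover have "inj_on (\<lambda>l. {y \<in> V. l = lab y}) (lab ` V)"
    by (rule inj_onI) auto
  ultimately show ?thesis by (simp add: num_classes_def card_image)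
qed

lemma sym_adj_rel: "sym (adj_rel G A)"
  by (auto simp: sym_def adj_rel_def insert_commute)

text \<open>By symmetry, two classes that meet coincide. This makes the class of a point a canonical
  label for it.\<close>

lemma sym_class_eq_iff:
  assumes "sym R"
  shows "(x, y) \<in> R\<^sup>* \<longleftrightarrow> {z. (x, z) \<in> R\<^sup>*} = {z. (y, z) \<in> R\<^sup>*}"
proof -
  have "sym (R\<^sup>*)" using assms by (rule sym_rtrancl)
  then show ?thesis by (blast intro: rtrancl_trans dest: symD)
qed

text \<open>A walk through the new link can be shortened until it uses the link at most once, in one
  of its two directions.\<close>

lemma rtrancl_add_edge:
  "(u, w) \<in> (insert (x, y) (insert (y, x) R))\<^sup>* \<longleftrightarrow>
     (u, w) \<in> R\<^sup>* \<or> (u, x) \<in> R\<^sup>* \<and> (y, w) \<in> R\<^sup>* \<or> (u, y) \<in> R\<^sup>* \<and> (x, w) \<in> R\<^sup>*"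
  by (auto simp: rtrancl_insert intro: rtrancl_trans)

text \<open>A union-find step: linking \<open>x\<close> and \<open>y\<close> renames the label of
  \<open>y\<close> to that of \<open>x\<close>.\<close>

lemma merge_labels:
  assumes lab: "\<And>u w. u \<in> V \<Longrightarrow> w \<in> V \<Longrightarrow> (u, w) \<in> R\<^sup>* \<longleftrightarrow> lab u = lab w"
    and "x \<in> V" "y \<in> V" "u \<in> V" "w \<in> V"
  shows "(u, w) \<in> (insert (x, y) (insert (y, x) R))\<^sup>* \<longleftrightarrow>
    (if lab u = lab y then lab x else lab u) = (if lab w = lab y then lab x else lab w)"
  using assms by (auto simp: rtrancl_add_edge)

lemma num_classes_add_edge:
  assumes "finite V" "sym R" "x \<in> V" "y \<in> V"
  shows "num_classes V (insert (x, y) (insert (y, x) R)) + (if (x, y) \<in> R\<^sup>* then 0 else 1) = num_classes V R"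
proof -
  define lab where "lab u = {z. (u, z) \<in> R\<^sup>*}" for u
  define lab' where "lab' u = (if lab u = lab y then lab x else lab u)" for u
  have lab: "(u, w) \<in> R\<^sup>* \<longleftrightarrow> lab u = lab w" for u w
    unfolding lab_def by (rule sym_class_eq_iff[OF assms(2)])
  have "(u, w) \<in> (insert (x, y) (insert (y, x) R))\<^sup>* \<longleftrightarrow> lab' u = lab' w"
    if "u \<in> V" "w \<in> V" for u w
    unfolding lab'_def by (rule merge_labels[OF lab]) (use assms that in auto)
  then have 1: "num_classes V (insert (x, y) (insert (y, x) R)) = card (lab' ` V)"
    by (rule num_classes_eq_card_labels)
  have 2: "num_classes V R = card (lab ` V)" by (rule num_classes_eq_card_labels) (rule lab)
  show ?thesis
  proof (cases "lab x = lab y")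
    case True
    then have "lab' ` V = lab ` V" by (intro image_cong) (auto simp: lab'_def)
    then show ?thesis using 1 2 True lab by simp
  next
    case False
    \<comment> \<open>The label of \<open>x\<close> is still attained at \<open>x\<close>, so
      exactly the label of \<open>y\<close> disappears.\<close>
    have "lab' ` V = lab ` V - {lab y}"
      using assms(3) False by (auto simp: lab'_def image_iff)
    moreover have "card (lab ` V) > 0" using assms by (auto simp: card_gt_0_iff)
    ultimately show ?thesis using 1 2 False lab assms by (simp add: card_Diff_singleton)
  qed
qed

text \<open>No step leaves the part in which the walk starts, so only the relation of that part is
  ever used.\<close>

lemma rtrancl_Un_disjoint:
  assumes "R1 \<subseteq> V1 \<times> V1" "R2 \<subseteq> V2 \<times> V2" "V1 \<inter> V2 = {}" "(x, y) \<in> (R1 \<union> R2)\<^sup>*"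
  shows "(x \<in> V1 \<longrightarrow> y \<in> V1 \<and> (x, y) \<in> R1\<^sup>*) \<and> (x \<in> V2 \<longrightarrow> y \<in> V2 \<and> (x, y) \<in> R2\<^sup>*)"
  using assms(4)
proof induction
  case base
  show ?case by simp
next
  case (step y z)
  have "(x, z) \<in> R1\<^sup>*" if "(x, y) \<in> R1\<^sup>*" "(y, z) \<in> R1" using that by simp
  moreover have "(x, z) \<in> R2\<^sup>*" if "(x, y) \<in> R2\<^sup>*" "(y, z) \<in> R2" using that by simp
  ultimately show ?case using step assms(1-3) by blast
qed

lemma rtrancl_Un_disjoint_iff:
  assumes "R1 \<subseteq> V1 \<times> V1" "R2 \<subseteq> V2 \<times> V2" "V1 \<inter> V2 = {}"
  shows "x \<in> V1 \<Longrightarrow> y \<in> V1 \<Longrightarrow> (x, y) \<in> (R1 \<union> R2)\<^sup>* \<longleftrightarrow> (x, y) \<in> R1\<^sup>*"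
    and "x \<in> V2 \<Longrightarrow> y \<in> V2 \<Longrightarrow> (x, y) \<in> (R1 \<union> R2)\<^sup>* \<longleftrightarrow> (x, y) \<in> R2\<^sup>*"
    and "x \<in> V1 \<Longrightarrow> y \<in> V2 \<Longrightarrow> (x, y) \<notin> (R1 \<union> R2)\<^sup>*"
    and "x \<in> V2 \<Longrightarrow> y \<in> V1 \<Longrightarrow> (x, y) \<notin> (R1 \<union> R2)\<^sup>*"
  using rtrancl_Un_disjoint[OF assms, of x y] assms(3)
    rtrancl_mono[of R1 "R1 \<union> R2"] rtrancl_mono[of R2 "R1 \<union> R2"] by auto

lemma num_classes_Un_disjoint:
  assumes "R1 \<subseteq> V1 \<times> V1" "R2 \<subseteq> V2 \<times> V2" "V1 \<inter> V2 = {}" "finite V1" "finite V2"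
  shows "num_classes (V1 \<union> V2) (R1 \<union> R2) = num_classes V1 R1 + num_classes V2 R2"
proof -
  let ?f = "\<lambda>x. {y \<in> V1 \<union> V2. (x, y) \<in> (R1 \<union> R2)\<^sup>*}"
  note iff = rtrancl_Un_disjoint_iff[OF assms(1-3)]
  have 1: "?f ` V1 = (\<lambda>x. {y \<in> V1. (x, y) \<in> R1\<^sup>*}) ` V1"
    using iff by (intro image_cong) auto
  have 2: "?f ` V2 = (\<lambda>x. {y \<in> V2. (x, y) \<in> R2\<^sup>*}) ` V2"
    using iff by (intro image_cong) auto
  have "?f ` V1 \<inter> ?f ` V2 = {}"
    unfolding 1 2 using assms(3) by auto
  then show ?thesis
    unfolding num_classes_def image_Un using assms(4,5) 1 2 by (simp add: card_Un_disjoint)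
qed

text \<open>\<open>K\<close> is \<open>R\<close> together with links between points that
  \<open>r\<close> identifies. Such links become stationary under \<open>r\<close>, so walks in the
  quotient are walks along \<open>K\<close>.\<close>

lemma rtrancl_map_prod_iff:
  assumes K: "\<And>x y. (x, y) \<in> K \<Longrightarrow> (x, y) \<in> R \<or> r x = r y"
    and "R \<subseteq> K" "K \<subseteq> V \<times> V"
    and r: "\<And>x y. x \<in> V \<Longrightarrow> y \<in> V \<Longrightarrow> r x = r y \<Longrightarrow> (x, y) \<in> K\<^sup>*"
    and "x \<in> V" "y \<in> V"
  shows "(r x, r y) \<in> (map_prod r r ` R)\<^sup>* \<longleftrightarrow> (x, y) \<in> K\<^sup>*"
proof
  assume "(r x, r y) \<in> (map_prod r r ` R)\<^sup>*"
  \<comment> \<open>All preimages \<open>w\<close> of the end point are treated at once, because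
    consecutive steps in the quotient may meet in different preimages of the same vertex.\<close>
  moreover have "\<forall>w \<in> V. z = r w \<longrightarrow> (x, w) \<in> K\<^sup>*"
    if "(r x, z) \<in> (map_prod r r ` R)\<^sup>*" for z
    using that
  proof induction
    case base
    then show ?case using r \<open>x \<in> V\<close> by auto
  next
    case (step z z')
    from step(2) obtain a b where ab: "(a, b) \<in> R" "z = r a" "z' = r b" by auto
    then have V: "a \<in> V" "b \<in> V" using assms(2,3) by auto
    show ?case
    proof (intro ballI impI)
      fix w assume "w \<in> V" "z' = r w"
      then have "(b, w) \<in> K\<^sup>*" using r ab V by auto
      moreover have "(x, a) \<in> K\<^sup>*" using step(3) ab V by auto
      moreover have "(a, b) \<in> K" using ab assms(2) by auto
      ultimately show "(x, w) \<in> K\<^sup>*" by (meson rtrancl.rtrancl_into_rtrancl rtrancl_trans)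
    qed
  qed
  ultimately show "(x, y) \<in> K\<^sup>*" using \<open>y \<in> V\<close> by blast
next
  assume "(x, y) \<in> K\<^sup>*"
  then show "(r x, r y) \<in> (map_prod r r ` R)\<^sup>*"
  proof induction
    case (step y z)
    show ?case using K[OF step(2)] step(3)
      by (metis map_prod_imageI rtrancl.rtrancl_into_rtrancl)
  qed simp
qed

text \<open>Replaces the identification of vertices by the addition of links, whose effect on the
  number of classes is known.\<close>

lemma num_classes_map_prod:
  assumes "\<And>x y. (x, y) \<in> K \<Longrightarrow> (x, y) \<in> R \<or> r x = r y"
    and "R \<subseteq> K" "K \<subseteq> V \<times> V"
    and "\<And>x y. x \<in> V \<Longrightarrow> y \<in> V \<Longrightarrow> r x = r y \<Longrightarrow> (x, y) \<in> K\<^sup>*"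
    and "sym R"
  shows "num_classes (r ` V) (map_prod r r ` R) = num_classes V K"
proof -
  let ?S = "map_prod r r ` R"
  define lab where "lab w = {z. (w, z) \<in> ?S\<^sup>*}" for w
  have "sym ?S" using assms(5) by (auto simp: sym_def)
  then have lab: "(u, w) \<in> ?S\<^sup>* \<longleftrightarrow> lab u = lab w" for u w
    unfolding lab_def by (rule sym_class_eq_iff)
  have "num_classes V K = card ((lab \<circ> r) ` V)"
  proof (rule num_classes_eq_card_labels)
    fix x y assume "x \<in> V" "y \<in> V"
    with assms(1-4) have "(r x, r y) \<in> ?S\<^sup>* \<longleftrightarrow> (x, y) \<in> K\<^sup>*"
      by (rule rtrancl_map_prod_iff)
    then show "(x, y) \<in> K\<^sup>* \<longleftrightarrow> (lab \<circ> r) x = (lab \<circ> r) y"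
      using lab[of "r x" "r y"] by simp
  qed
  also have "(lab \<circ> r) ` V = lab ` r ` V" by (rule image_comp[symmetric])
  also have "card \<dots> = num_classes (r ` V) ?S"
    by (rule num_classes_eq_card_labels[symmetric]) (rule lab)
  finally show ?thesis by simp
qed

section \<open>Series and parallel composition\<close>

lemma adj_rel_subset: "wf_tgraph G \<Longrightarrow> A \<subseteq> edges G \<Longrightarrow> adj_rel G A \<subseteq> verts G \<times> verts G"
  by (force simp: wf_tgraph_def adj_rel_def)

lemma conn_sym: "(x, y) \<in> (adj_rel G A)\<^sup>* \<longleftrightarrow> (y, x) \<in> (adj_rel G A)\<^sup>*"
  using sym_rtrancl[OF sym_adj_rel[of G A]] by (auto dest: symD)

definition weight :: "tgraph \<Rightarrow> complex \<Rightarrow> nat set \<Rightarrow> complex" where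
  "weight G q A = q ^ num_comp G A * (-1) ^ card A"

definition joined :: "tgraph \<Rightarrow> nat set \<Rightarrow> bool" where
  "joined G A \<longleftrightarrow> (src G, tgt G) \<in> (adj_rel G A)\<^sup>*"

text \<open>The numerator of the transmissivity; its denominator is
  \<open>chrom_poly\<close>.\<close>

definition conn_poly :: "tgraph \<Rightarrow> complex \<Rightarrow> complex" where
  "conn_poly G q = (\<Sum>A\<in>Pow (edges G). weight G q A * of_bool (joined G A))"

lemma chrom_poly_eq_sum_weight: "chrom_poly G q = (\<Sum>A\<in>Pow (edges G). weight G q A)"
  by (simp add: chrom_poly_def weight_def)

lemma sum_Pow_Un_disjoint:
  assumes "E1 \<inter> E2 = {}"
  shows "(\<Sum>A\<in>Pow (E1 \<union> E2). f A) = (\<Sum>A\<in>Pow E1. \<Sum>B\<in>Pow E2. f (A \<union> B))"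
proof -
  have "(\<Sum>A\<in>Pow E1. \<Sum>B\<in>Pow E2. f (A \<union> B)) = (\<Sum>(A, B)\<in>Pow E1 \<times> Pow E2. f (A \<union> B))"
    by (rule sum.cartesian_product)
  also have "\<dots> = (\<Sum>A\<in>Pow (E1 \<union> E2). f A)"
    by (rule sum.reindex_bij_witness[of _ "\<lambda>A. (A \<inter> E1, A \<inter> E2)" "\<lambda>(A, B). A \<union> B"])
      (use assms in \<open>auto intro!: arg_cong[of _ _ f]\<close>)
  finally show ?thesis by simp
qed

section \<open>Gluing two disjoint graphs at terminals\<close>

locale disjoint_tgraphs =
  fixes G1 G2 :: tgraph
  assumes wf1: "wf_tgraph G1" and wf2: "wf_tgraph G2"
    and disjoint_verts: "verts G1 \<inter> verts G2 = {}"
    and disjoint_edges: "edges G1 \<inter> edges G2 = {}"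
begin

text \<open>A common form of both compositions as a quotient of the disjoint union: \<open>r\<close>
  acts on both graphs alike, so that the lemmas on quotients apply.\<close>

definition glue :: "(nat \<Rightarrow> nat) \<Rightarrow> nat \<Rightarrow> nat \<Rightarrow> tgraph" where
  "glue r s t = \<lparr>verts = r ` (verts G1 \<union> verts G2), edges = edges G1 \<union> edges G2,
     inc = (\<lambda>e. r ` (if e \<in> edges G1 then inc G1 e else inc G2 e)), src = s, tgt = t\<rparr>"

definition par_map :: "nat \<Rightarrow> nat" where
  "par_map x = (if x = src G2 then src G1 else if x = tgt G2 then tgt G1 else x)"

definition ser_map :: "nat \<Rightarrow> nat" where
  "ser_map x = (if x = src G2 then tgt G1 else x)"

lemma terminals:
  "src G1 \<in> verts G1" "tgt G1 \<in> verts G1" "src G1 \<noteq> tgt G1"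
  "src G2 \<in> verts G2" "tgt G2 \<in> verts G2" "src G2 \<noteq> tgt G2"
  using wf1 wf2 by (auto simp: wf_tgraph_def)

lemma not_in_both: "x \<in> verts G1 \<Longrightarrow> x \<in> verts G2 \<Longrightarrow> False"
  using disjoint_verts by blast

lemma par_map_eq [simp]: "x \<in> verts G1 \<Longrightarrow> par_map x = x"
  and ser_map_eq [simp]: "x \<in> verts G1 \<Longrightarrow> ser_map x = x"
  using terminals not_in_both by (auto simp: par_map_def ser_map_def)

lemma glue_eqI:
  assumes "\<And>x. x \<in> verts G1 \<Longrightarrow> r x = x"
  shows "\<lparr>verts = verts G1 \<union> r ` verts G2, edges = edges G1 \<union> edges G2,
      inc = (\<lambda>e. if e \<in> edges G1 then inc G1 e else r ` inc G2 e), src = s, tgt = t\<rparr> = glue r s t"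
proof -
  have "r ` verts G1 = verts G1" using assms by simp
  moreover have "r ` inc G1 e = inc G1 e" if "e \<in> edges G1" for e
    using assms that wf1 by (force simp: wf_tgraph_def)
  ultimately show ?thesis by (auto simp: glue_def image_Un fun_eq_iff)
qed

lemma par_comp_eq: "par_comp G1 G2 = glue par_map (src G1) (tgt G1)"
proof -
  have "(\<lambda>x. if x = src G2 then src G1 else if x = tgt G2 then tgt G1 else x) = par_map"
    by (simp add: par_map_def fun_eq_iff)
  then show ?thesis by (simp add: par_comp_def glue_eqI)
qed

lemma ser_comp_eq: "ser_comp G1 G2 = glue ser_map (src G1) (tgt G2)"
proof -
  have "(\<lambda>x. if x = src G2 then tgt G1 else x) = ser_map"
    by (simp add: ser_map_def fun_eq_iff)
  then show ?thesis by (simp add: ser_comp_def glue_eqI)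
qed

lemma wf_glue:
  assumes "inj_on r (verts G1)" "inj_on r (verts G2)"
    and "s \<in> r ` (verts G1 \<union> verts G2)" "t \<in> r ` (verts G1 \<union> verts G2)" "s \<noteq> t"
  shows "wf_tgraph (glue r s t)"
proof -
  have "card (r ` inc G1 e) = 2" if "e \<in> edges G1" for e
    using that wf1 assms(1) by (auto simp: wf_tgraph_def card_image inj_on_subset)
  moreover have "card (r ` inc G2 e) = 2" if "e \<in> edges G2" for e
    using that wf2 assms(2) by (auto simp: wf_tgraph_def card_image inj_on_subset)
  moreover have "r ` inc G1 e \<subseteq> r ` (verts G1 \<union> verts G2)" if "e \<in> edges G1" for e
    using that wf1 by (intro image_mono) (auto simp: wf_tgraph_def)
  moreover have "r ` inc G2 e \<subseteq> r ` (verts G1 \<union> verts G2)" if "e \<in> edges G2" for e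
    using that wf2 by (intro image_mono) (auto simp: wf_tgraph_def)
  moreover have "finite (verts G1)" "finite (verts G2)" "finite (edges G1)" "finite (edges G2)"
    using wf1 wf2 by (auto simp: wf_tgraph_def)
  ultimately show ?thesis
    using assms(3-) unfolding wf_tgraph_def glue_def by (simp del: image_Un) (metis UnE)
qed

lemma inj_on_par_map: "inj_on par_map (verts G2)"
  and inj_on_ser_map: "inj_on ser_map (verts G2)"
  using terminals not_in_both by (auto simp: inj_on_def par_map_def ser_map_def)

lemma wf_par_comp: "wf_tgraph (par_comp G1 G2)"
  unfolding par_comp_eq
proof (rule wf_glue)
  show "src G1 \<in> par_map ` (verts G1 \<union> verts G2)"
    using terminals by (auto simp: image_iff intro!: bexI[of _ "src G1"])
  show "tgt G1 \<in> par_map ` (verts G1 \<union> verts G2)"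
    using terminals by (auto simp: image_iff intro!: bexI[of _ "tgt G1"])
qed (use terminals inj_on_par_map in \<open>auto simp: inj_on_def\<close>)

lemma ser_map_tgt: "ser_map (tgt G2) = tgt G2"
  using terminals by (simp add: ser_map_def)

lemma wf_ser_comp: "wf_tgraph (ser_comp G1 G2)"
  unfolding ser_comp_eq
proof (rule wf_glue)
  show "src G1 \<in> ser_map ` (verts G1 \<union> verts G2)"
    using terminals by (auto simp: image_iff intro!: bexI[of _ "src G1"])
  show "tgt G2 \<in> ser_map ` (verts G1 \<union> verts G2)"
    using terminals ser_map_tgt by (auto simp: image_iff intro!: bexI[of _ "tgt G2"])
  show "src G1 \<noteq> tgt G2" using terminals not_in_both by metis
qed (use inj_on_ser_map in \<open>auto simp: inj_on_def\<close>)

lemma adj_rel_glue: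
  assumes "A1 \<subseteq> edges G1" "A2 \<subseteq> edges G2"
  shows "adj_rel (glue r s t) (A1 \<union> A2) = map_prod r r ` (adj_rel G1 A1 \<union> adj_rel G2 A2)"
proof -
  define inc' where "inc' e = (if e \<in> edges G1 then inc G1 e else inc G2 e)" for e
  have card: "card (inc' e) = 2" if "e \<in> A1 \<union> A2" for e
    using that assms wf1 wf2 by (auto simp: inc'_def wf_tgraph_def)
  have "inc' e = inc G2 e" if "e \<in> A2" for e
    using that assms disjoint_edges by (auto simp: inc'_def)
  moreover have "inc' e = inc G1 e" if "e \<in> A1" for e
    using that assms by (auto simp: inc'_def)
  ultimately have "adj_rel G1 A1 \<union> adj_rel G2 A2 = {(x, y). \<exists>e\<in>A1 \<union> A2. inc' e = {x, y}}"
    by (auto simp: adj_rel_def bex_Un)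
  moreover have "map_prod r r ` {(x, y). \<exists>e\<in>A1 \<union> A2. inc' e = {x, y}} =
      {(x, y). \<exists>e\<in>A1 \<union> A2. r ` inc' e = {x, y}}"
  proof (intro equalityI subsetI)
    fix z assume "z \<in> {(x, y). \<exists>e\<in>A1 \<union> A2. r ` inc' e = {x, y}}"
    then obtain x y e where z: "z = (x, y)" and e: "e \<in> A1 \<union> A2" "r ` inc' e = {x, y}" by blast
    \<comment> \<open>An edge has exactly two ends, so the ends of its image lift to an ordered pair
      of preimages, in one of the two orders.\<close>
    from e(1) obtain a b where "inc' e = {a, b}" using card[of e] unfolding card_2_iff by blast
    then have "inc' e = {a, b} \<and> r a = x \<and> r b = y \<or> inc' e = {b, a} \<and> r b = x \<and> r a = y"
      using e(2) by (auto simp: doubleton_eq_iff)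
    then show "z \<in> map_prod r r ` {(x, y). \<exists>e\<in>A1 \<union> A2. inc' e = {x, y}}"
      using e(1) unfolding z by (auto simp: image_iff)
  next
    fix z assume "z \<in> map_prod r r ` {(x, y). \<exists>e\<in>A1 \<union> A2. inc' e = {x, y}}"
    then obtain a b e where "z = (r a, r b)" "e \<in> A1 \<union> A2" "inc' e = {a, b}" by auto
    moreover from this have "r ` inc' e = {r a, r b}" by simp
    ultimately show "z \<in> {(x, y). \<exists>e\<in>A1 \<union> A2. r ` inc' e = {x, y}}" by blast
  qed
  ultimately show ?thesis by (simp add: adj_rel_def glue_def inc'_def)
qed

text \<open>Before gluing, the two graphs are unconnected. The single link from
  \<open>tgt G1\<close> to \<open>src G2\<close> therefore always merges two components, and every
  connection of the outer terminals must pass through it.\<close>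

lemma
  assumes "A1 \<subseteq> edges G1" "A2 \<subseteq> edges G2"
  shows num_comp_ser: "Suc (num_comp (ser_comp G1 G2) (A1 \<union> A2)) = num_comp G1 A1 + num_comp G2 A2"
    and joined_ser: "joined (ser_comp G1 G2) (A1 \<union> A2) \<longleftrightarrow> joined G1 A1 \<and> joined G2 A2"
proof -
  let ?V = "verts G1 \<union> verts G2"
  define R where "R = adj_rel G1 A1 \<union> adj_rel G2 A2"
  define K where "K = insert (tgt G1, src G2) (insert (src G2, tgt G1) R)"
  note sub = adj_rel_subset[OF wf1 assms(1)] adj_rel_subset[OF wf2 assms(2)]
  note iff = rtrancl_Un_disjoint_iff[OF sub disjoint_verts, folded R_def]
  have fin: "finite (verts G1)" "finite (verts G2)" using wf1 wf2 by (auto simp: wf_tgraph_def)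
  have symR: "sym R" unfolding R_def by (intro sym_Un sym_adj_rel)
  have K: "(x, y) \<in> R \<or> ser_map x = ser_map y" if "(x, y) \<in> K" for x y
    using that terminals by (auto simp: K_def) (auto simp: ser_map_def)
  have RK: "R \<subseteq> K" by (auto simp: K_def)
  have KV: "K \<subseteq> ?V \<times> ?V" using sub terminals by (auto simp: K_def R_def)
  have rK: "(x, y) \<in> K\<^sup>*" if "x \<in> ?V" "y \<in> ?V" "ser_map x = ser_map y" for x y
    using that by (auto simp: ser_map_def K_def split: if_splits)
  have adj: "adj_rel (ser_comp G1 G2) (A1 \<union> A2) = map_prod ser_map ser_map ` R"
    unfolding ser_comp_eq R_def by (rule adj_rel_glue[OF assms])
  have "num_comp (ser_comp G1 G2) (A1 \<union> A2) = num_classes (ser_map ` ?V) (map_prod ser_map ser_map ` R)"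
    unfolding num_comp_eq_num_classes adj by (simp add: ser_comp_eq glue_def)
  also have "\<dots> = num_classes ?V K" using K RK KV rK symR by (rule num_classes_map_prod)
  also have "Suc (num_classes ?V K) = num_classes ?V R"
    using num_classes_add_edge[OF _ symR, of ?V "tgt G1" "src G2"] fin terminals iff by (simp add: K_def)
  also have "\<dots> = num_classes (verts G1) (adj_rel G1 A1) + num_classes (verts G2) (adj_rel G2 A2)"
    unfolding R_def by (rule num_classes_Un_disjoint[OF sub disjoint_verts fin])
  finally show "Suc (num_comp (ser_comp G1 G2) (A1 \<union> A2)) = num_comp G1 A1 + num_comp G2 A2"
    by (simp add: num_comp_eq_num_classes)
  have "joined (ser_comp G1 G2) (A1 \<union> A2) \<longleftrightarrow>
      (ser_map (src G1), ser_map (tgt G2)) \<in> (map_prod ser_map ser_map ` R)\<^sup>*"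
    unfolding joined_def adj using terminals ser_map_tgt by (simp add: ser_comp_eq glue_def)
  also have "\<dots> \<longleftrightarrow> (src G1, tgt G2) \<in> K\<^sup>*"
    using K RK KV rK by (rule rtrancl_map_prod_iff) (use terminals in auto)
  also have "\<dots> \<longleftrightarrow> joined G1 A1 \<and> joined G2 A2"
    unfolding K_def rtrancl_add_edge joined_def using iff terminals by auto
  finally show "joined (ser_comp G1 G2) (A1 \<union> A2) \<longleftrightarrow> joined G1 A1 \<and> joined G2 A2" .
qed

text \<open>The link between the sources (\<open>K'\<close>) always merges two components. The link
  between the targets (\<open>K\<close>) merges two more unless the targets are already connected by
  way of the sources, that is, unless both edge sets join their terminals.\<close>

lemma
  assumes "A1 \<subseteq> edges G1" "A2 \<subseteq> edges G2"
  shows num_comp_par: "num_comp (par_comp G1 G2) (A1 \<union> A2) +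
      (if joined G1 A1 \<and> joined G2 A2 then 1 else 2) = num_comp G1 A1 + num_comp G2 A2"
    and joined_par: "joined (par_comp G1 G2) (A1 \<union> A2) \<longleftrightarrow> joined G1 A1 \<or> joined G2 A2"
proof -
  let ?V = "verts G1 \<union> verts G2"
  define R where "R = adj_rel G1 A1 \<union> adj_rel G2 A2"
  define K' where "K' = insert (src G1, src G2) (insert (src G2, src G1) R)"
  define K where "K = insert (tgt G1, tgt G2) (insert (tgt G2, tgt G1) K')"
  note sub = adj_rel_subset[OF wf1 assms(1)] adj_rel_subset[OF wf2 assms(2)]
  note iff = rtrancl_Un_disjoint_iff[OF sub disjoint_verts, folded R_def]
  have fin: "finite (verts G1)" "finite (verts G2)" using wf1 wf2 by (auto simp: wf_tgraph_def)
  have symR: "sym R" unfolding R_def by (intro sym_Un sym_adj_rel)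
  then have symK': "sym K'" by (auto simp: K'_def sym_def)
  have K: "(x, y) \<in> R \<or> par_map x = par_map y" if "(x, y) \<in> K" for x y
  proof -
    have "par_map (src G2) = src G1" "par_map (tgt G2) = tgt G1"
      using terminals by (auto simp: par_map_def)
    then show ?thesis using that terminals by (auto simp: K_def K'_def)
  qed
  have RK: "R \<subseteq> K" by (auto simp: K_def K'_def)
  have KV: "K \<subseteq> ?V \<times> ?V" using sub terminals by (auto simp: K_def K'_def R_def)
  have rK: "(x, y) \<in> K\<^sup>*" if "x \<in> ?V" "y \<in> ?V" "par_map x = par_map y" for x y
    using that terminals by (auto simp: par_map_def K_def K'_def split: if_splits)
  have adj: "adj_rel (par_comp G1 G2) (A1 \<union> A2) = map_prod par_map par_map ` R"
    unfolding par_comp_eq R_def by (rule adj_rel_glue[OF assms])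
  have src_tgt: "(src G1, tgt G1) \<in> R\<^sup>* \<longleftrightarrow> joined G1 A1" "(tgt G1, src G1) \<in> R\<^sup>* \<longleftrightarrow> joined G1 A1"
    "(src G2, tgt G2) \<in> R\<^sup>* \<longleftrightarrow> joined G2 A2" "(tgt G2, src G2) \<in> R\<^sup>* \<longleftrightarrow> joined G2 A2"
    using iff terminals conn_sym by (auto simp: joined_def)
  have across: "(x, y) \<notin> R\<^sup>*" "(y, x) \<notin> R\<^sup>*" if "x \<in> {src G1, tgt G1}" "y \<in> {src G2, tgt G2}" for x y
    using that iff terminals by auto
  have "num_comp (par_comp G1 G2) (A1 \<union> A2) = num_classes (par_map ` ?V) (map_prod par_map par_map ` R)"
    unfolding num_comp_eq_num_classes adj by (simp add: par_comp_eq glue_def)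
  also have "\<dots> = num_classes ?V K" using K RK KV rK symR by (rule num_classes_map_prod)
  finally have 1: "num_comp (par_comp G1 G2) (A1 \<union> A2) = num_classes ?V K" .
  have "(tgt G1, tgt G2) \<in> K'\<^sup>* \<longleftrightarrow> joined G1 A1 \<and> joined G2 A2"
    unfolding K'_def rtrancl_add_edge using src_tgt across by auto
  then have 2: "num_classes ?V K + (if joined G1 A1 \<and> joined G2 A2 then 0 else 1) = num_classes ?V K'"
    using num_classes_add_edge[OF _ symK', of ?V "tgt G1" "tgt G2"] fin terminals by (simp add: K_def)
  have 3: "num_classes ?V K' + 1 = num_classes ?V R"
    using num_classes_add_edge[OF _ symR, of ?V "src G1" "src G2"] fin terminals across by (simp add: K'_def)
  have 4: "num_classes ?V R = num_classes (verts G1) (adj_rel G1 A1) + num_classes (verts G2) (adj_rel G2 A2)"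
    unfolding R_def by (rule num_classes_Un_disjoint[OF sub disjoint_verts fin])
  show "num_comp (par_comp G1 G2) (A1 \<union> A2) +
      (if joined G1 A1 \<and> joined G2 A2 then 1 else 2) = num_comp G1 A1 + num_comp G2 A2"
    using 1 2 3 4 by (auto simp: num_comp_eq_num_classes split: if_splits)
  have "joined (par_comp G1 G2) (A1 \<union> A2) \<longleftrightarrow>
      (par_map (src G1), par_map (tgt G1)) \<in> (map_prod par_map par_map ` R)\<^sup>*"
    unfolding joined_def adj using terminals by (simp add: par_comp_eq glue_def)
  also have "\<dots> \<longleftrightarrow> (src G1, tgt G1) \<in> K\<^sup>*"
    using K RK KV rK by (rule rtrancl_map_prod_iff) (use terminals in auto)
  also have "\<dots> \<longleftrightarrow> joined G1 A1 \<or> joined G2 A2"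
    unfolding K_def rtrancl_add_edge[of _ _ "tgt G1"] unfolding K'_def rtrancl_add_edge
    using src_tgt across by auto
  finally show "joined (par_comp G1 G2) (A1 \<union> A2) \<longleftrightarrow> joined G1 A1 \<or> joined G2 A2" .
qed

section \<open>Composition laws for the polynomials\<close>

lemma card_Un_edges:
  assumes "A1 \<subseteq> edges G1" "A2 \<subseteq> edges G2"
  shows "card (A1 \<union> A2) = card A1 + card A2"
proof (rule card_Un_disjoint)
  show "finite A1" "finite A2" using assms wf1 wf2 by (auto simp: wf_tgraph_def intro: finite_subset)
  show "A1 \<inter> A2 = {}" using assms disjoint_edges by blast
qed

text \<open>The component lost in gluing is made up for by the factor \<open>q\<close> on the left,
  which avoids a division.\<close>

lemma weight_ser:
  assumes "A1 \<subseteq> edges G1" "A2 \<subseteq> edges G2"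
  shows "q * weight (ser_comp G1 G2) q (A1 \<union> A2) = weight G1 q A1 * weight G2 q A2"
  using num_comp_ser[OF assms, symmetric] card_Un_edges[OF assms]
  by (simp add: weight_def power_add mult_ac flip: power_Suc power_add)

lemma weight_par:
  assumes "A1 \<subseteq> edges G1" "A2 \<subseteq> edges G2"
  shows "q\<^sup>2 * weight (par_comp G1 G2) q (A1 \<union> A2) =
    (if joined G1 A1 \<and> joined G2 A2 then q else 1) * (weight G1 q A1 * weight G2 q A2)"
proof -
  let ?k = "num_comp (par_comp G1 G2) (A1 \<union> A2)"
  have "q\<^sup>2 * q ^ ?k = (if joined G1 A1 \<and> joined G2 A2 then q else 1) *
      q ^ (?k + (if joined G1 A1 \<and> joined G2 A2 then 1 else 2))"
    by (simp add: power2_eq_square)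
  also have "\<dots> = (if joined G1 A1 \<and> joined G2 A2 then q else 1) *
      (q ^ num_comp G1 A1 * q ^ num_comp G2 A2)"
    unfolding num_comp_par[OF assms] power_add ..
  finally show ?thesis
    unfolding weight_def card_Un_edges[OF assms] power_add by (simp add: mult_ac)
qed

lemma edges_par: "edges (par_comp G1 G2) = edges G1 \<union> edges G2"
  and edges_ser: "edges (ser_comp G1 G2) = edges G1 \<union> edges G2"
  by (simp_all add: par_comp_eq ser_comp_eq glue_def)

lemma chrom_poly_ser: "q * chrom_poly (ser_comp G1 G2) q = chrom_poly G1 q * chrom_poly G2 q"
  unfolding chrom_poly_eq_sum_weight edges_ser sum_Pow_Un_disjoint[OF disjoint_edges]
    sum_product
  unfolding sum_distrib_left
  by (intro sum.cong refl) (simp add: weight_ser)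

lemma conn_poly_ser: "q * conn_poly (ser_comp G1 G2) q = conn_poly G1 q * conn_poly G2 q"
  unfolding conn_poly_def edges_ser sum_Pow_Un_disjoint[OF disjoint_edges]
    sum_product
  unfolding sum_distrib_left
  by (intro sum.cong refl) (simp add: weight_ser[symmetric] joined_ser)

text \<open>The factor in \<open>weight_par\<close> is \<open>1 + (q - 1) * a * b\<close>, where
  \<open>a\<close> and \<open>b\<close> are the indicators that the two edge sets join their
  terminals.\<close>

lemma chrom_poly_par:
  "q\<^sup>2 * chrom_poly (par_comp G1 G2) q =
     chrom_poly G1 q * chrom_poly G2 q + (q - 1) * (conn_poly G1 q * conn_poly G2 q)"
  unfolding chrom_poly_eq_sum_weight conn_poly_def edges_par sum_Pow_Un_disjoint[OF disjoint_edges]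
    sum_product
  unfolding sum_distrib_left sum.distrib[symmetric]
  by (intro sum.cong refl) (auto simp: weight_par algebra_simps)

text \<open>With indicators \<open>a\<close> and \<open>b\<close>, being joined in parallel has
  indicator \<open>a + b - a * b\<close>. Multiplied by \<open>1 + (q - 1) * a * b\<close> this is
  \<open>a + b + (q - 2) * a * b\<close>.\<close>

lemma conn_poly_par:
  "q\<^sup>2 * conn_poly (par_comp G1 G2) q = conn_poly G1 q * chrom_poly G2 q +
     chrom_poly G1 q * conn_poly G2 q + (q - 2) * (conn_poly G1 q * conn_poly G2 q)"
  unfolding chrom_poly_eq_sum_weight conn_poly_def edges_par sum_Pow_Un_disjoint[OF disjoint_edges]
    sum_product
  unfolding sum_distrib_left sum.distrib[symmetric] mult.assoc[symmetric]
  by (intro sum.cong refl) (auto simp: weight_par joined_par algebra_simps)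

end

section \<open>The edge and the Wheatstone bridge\<close>

text \<open>Entry \<open>u\<close> of the list names the component of vertex \<open>u\<close>. In
  this form the simplifier can evaluate the polynomials of concrete graphs.\<close>

definition represents :: "nat list \<Rightarrow> tgraph \<Rightarrow> nat set \<Rightarrow> bool" where
  "represents lab G A \<longleftrightarrow> verts G = {..<length lab} \<and>
     (\<forall>u<length lab. \<forall>w<length lab. (u, w) \<in> (adj_rel G A)\<^sup>* \<longleftrightarrow> lab ! u = lab ! w)"

lemma num_comp_represents: "represents lab G A \<Longrightarrow> num_comp G A = card (set lab)"
proof -
  assume "represents lab G A"
  then have V: "verts G = {..<length lab}" and
    lab: "\<And>u w. u \<in> verts G \<Longrightarrow> w \<in> verts G \<Longrightarrow> (u, w) \<in> (adj_rel G A)\<^sup>* \<longleftrightarrow> lab ! u = lab ! w"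
    by (auto simp: represents_def)
  have "num_comp G A = card ((!) lab ` verts G)"
    unfolding num_comp_eq_num_classes by (rule num_classes_eq_card_labels) (rule lab)
  also have "(!) lab ` verts G = set lab" by (auto simp: V set_conv_nth)
  finally show ?thesis .
qed

lemma represents_empty:
  assumes "verts G = {..<n}"
  shows "represents [0..<n] G {}"
proof -
  have "adj_rel G {} = {}" by (auto simp: adj_rel_def)
  then show ?thesis using assms by (simp add: represents_def)
qed

lemma adj_rel_insert:
  "inc G e = {x, y} \<Longrightarrow> adj_rel G (insert e A) = insert (x, y) (insert (y, x) (adj_rel G A))"
  by (auto simp: adj_rel_def doubleton_eq_iff)

lemma represents_insert:
  assumes "represents lab G A" "inc G e = {x, y}" "{x, y} \<subseteq> verts G"
  shows "represents (map (\<lambda>l. if l = lab ! y then lab ! x else l) lab) G (insert e A)"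
proof -
  have "(u, w) \<in> (insert (x, y) (insert (y, x) (adj_rel G A)))\<^sup>* \<longleftrightarrow>
    (if lab ! u = lab ! y then lab ! x else lab ! u) = (if lab ! w = lab ! y then lab ! x else lab ! w)"
    if "u \<in> {..<length lab}" "w \<in> {..<length lab}" for u w
    by (rule merge_labels[where V = "{..<length lab}"])
      (use assms that in \<open>auto simp: represents_def\<close>)
  then show ?thesis
    using assms(1) unfolding represents_def adj_rel_insert[OF assms(2)] by simp
qed

text \<open>Deletion-contraction on component labels: adding the edge \<open>e\<close> merges the labels of \<open>x\<close> and \<open>y\<close>.\<close>

fun merge_sum :: "(nat list \<Rightarrow> complex) \<Rightarrow> (nat \<times> nat \<times> nat) list \<Rightarrow> nat list \<Rightarrow> complex" where
  "merge_sum h [] lab = h lab"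
| "merge_sum h ((e, x, y) # es) lab =
     merge_sum h es lab - merge_sum h es (map (\<lambda>l. if l = lab ! y then lab ! x else l) lab)"

lemma sum_Pow_insert:
  assumes "finite S" "e \<notin> S"
  shows "(\<Sum>A\<in>Pow (insert e S). f A) = (\<Sum>A\<in>Pow S. f A) + (\<Sum>A\<in>Pow S. f (insert e A))"
proof -
  have "Pow S \<inter> insert e ` Pow S = {}" using assms by auto
  moreover have "inj_on (insert e) (Pow S)"
    using assms by (auto simp: inj_on_def)
  ultimately show ?thesis
    using assms by (simp add: Pow_insert sum.union_disjoint sum.reindex)
qed

text \<open>\<open>B\<close> collects the edges already chosen and \<open>lab\<close> describes its
  components. The induction decides on one more edge; choosing it changes the sign, which is the
  subtraction in \<open>merge_sum\<close>.\<close>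

lemma sum_Pow_eq_merge_sum:
  assumes H: "\<And>A lab. represents lab G A \<Longrightarrow> H A = h lab"
    and "represents lab G B"
    and "\<And>e x y. (e, x, y) \<in> set es \<Longrightarrow> inc G e = {x, y} \<and> {x, y} \<subseteq> verts G"
    and "distinct (map fst es)"
  shows "(\<Sum>A\<in>Pow (fst ` set es). (- 1) ^ card A * H (B \<union> A)) = merge_sum h es lab"
  using assms(2-)
proof (induction es arbitrary: lab B)
  case Nil
  then show ?case using H by simp
next
  case (Cons p es)
  obtain e x y where p: "p = (e, x, y)" by (cases p)
  let ?S = "fst ` set es"
  have e: "e \<notin> ?S" using Cons.prems(3) p by auto
  have card: "card (insert e A) = Suc (card A)" if "A \<in> Pow ?S" for A
  proof -
    have "finite A" using that finite_subset by auto
    moreover have "e \<notin> A" using that e by auto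
    ultimately show ?thesis by simp
  qed
  have inc: "inc G e = {x, y}" "{x, y} \<subseteq> verts G" using Cons.prems(2)[of e x y] p by auto
  have IH: "(\<Sum>A\<in>Pow ?S. (- 1) ^ card A * H (B \<union> A)) = merge_sum h es lab"
    if "represents lab G B" for lab B
    using that by (rule Cons.IH) (use Cons.prems(2,3) in auto)
  have "(\<Sum>A\<in>Pow ?S. (- 1) ^ card (insert e A) * H (B \<union> insert e A)) =
      - (\<Sum>A\<in>Pow ?S. (- 1) ^ card A * H (insert e B \<union> A))"
    unfolding sum_negf[symmetric] by (intro sum.cong refl) (simp add: card)
  also have "\<dots> = - merge_sum h es (map (\<lambda>l. if l = lab ! y then lab ! x else l) lab)"
    using IH[OF represents_insert[OF Cons.prems(1) inc]] by simp
  finally show ?case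
    using IH[OF Cons.prems(1)] e by (simp add: p sum_Pow_insert)
qed

lemma
  assumes "verts G = {..<n}" "edges G = fst ` set es"
    and "\<And>e x y. (e, x, y) \<in> set es \<Longrightarrow> inc G e = {x, y} \<and> {x, y} \<subseteq> verts G"
    and "distinct (map fst es)"
  shows chrom_poly_eq_merge_sum:
      "chrom_poly G q = merge_sum (\<lambda>lab. q ^ card (set lab)) es [0..<n]"
    and conn_poly_eq_merge_sum: "src G < n \<Longrightarrow> tgt G < n \<Longrightarrow> conn_poly G q =
      merge_sum (\<lambda>lab. q ^ card (set lab) * of_bool (lab ! src G = lab ! tgt G)) es [0..<n]"
proof -
  note rep = represents_empty[OF assms(1)]
  show "chrom_poly G q = merge_sum (\<lambda>lab. q ^ card (set lab)) es [0..<n]"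
    using sum_Pow_eq_merge_sum[OF _ rep assms(3,4), of "\<lambda>A. q ^ num_comp G A" "\<lambda>lab. q ^ card (set lab)"]
    by (simp add: chrom_poly_def num_comp_represents assms(2) mult.commute)
  assume st: "src G < n" "tgt G < n"
  have H: "q ^ num_comp G A * of_bool (joined G A) =
      q ^ card (set lab) * of_bool (lab ! src G = lab ! tgt G)" if "represents lab G A" for A lab
  proof -
    have "length lab = n" using that assms(1) by (simp add: represents_def)
    then show ?thesis
      using num_comp_represents[OF that] that st by (simp add: represents_def joined_def)
  qed
  have "(\<Sum>A\<in>Pow (fst ` set es).
      (- 1) ^ card A * (q ^ num_comp G ({} \<union> A) * of_bool (joined G ({} \<union> A)))) =
    merge_sum (\<lambda>lab. q ^ card (set lab) * of_bool (lab ! src G = lab ! tgt G)) es [0..<n]"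
    by (rule sum_Pow_eq_merge_sum[where H = "\<lambda>A. q ^ num_comp G A * of_bool (joined G A)",
          OF H rep assms(3,4)])
  then show "conn_poly G q =
      merge_sum (\<lambda>lab. q ^ card (set lab) * of_bool (lab ! src G = lab ! tgt G)) es [0..<n]"
    by (simp add: conn_poly_def weight_def assms(2) mult_ac del: of_bool_eq_0_iff sum_mult_of_bool_eq sum_of_bool_mult_eq)
qed

lemma chrom_poly_K2: "chrom_poly K2 q = q * (q - 1)"
  and conn_poly_K2: "conn_poly K2 q = - q"
proof -
  have *: "verts K2 = {..<2}" "edges K2 = fst ` set [(0, 0, 1)]" by (auto simp: K2_def)
  show "chrom_poly K2 q = q * (q - 1)"
    by (subst chrom_poly_eq_merge_sum[OF *])
      (auto simp: K2_def numeral_2_eq_2 algebra_simps)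
  show "conn_poly K2 q = - q"
    by (subst conn_poly_eq_merge_sum[OF *]) (auto simp: K2_def numeral_2_eq_2)
qed

lemma chrom_poly_wheatstone: "chrom_poly wheatstone q = q * (q - 1) * (q - 2)\<^sup>2"
  and conn_poly_wheatstone: "conn_poly wheatstone q = 2 * q * (q - 2)"
proof -
  let ?es = "[(0, 0, 2), (1, 0, 3), (2, 1, 2), (3, 1, 3), (4, 2, 3)]"
  have *: "verts wheatstone = {..<4}" "edges wheatstone = fst ` set ?es"
    by (auto simp: wheatstone_def)
  have upt: "[0..<4] = [0, 1, 2, 3 :: nat]" by (simp add: upt_rec)
  show "chrom_poly wheatstone q = q * (q - 1) * (q - 2)\<^sup>2"
    by (subst chrom_poly_eq_merge_sum[OF *])
      (auto simp: wheatstone_def upt card_insert_if eval_nat_numeral algebra_simps)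
  show "conn_poly wheatstone q = 2 * q * (q - 2)"
    by (subst conn_poly_eq_merge_sum[OF *])
      (auto simp: wheatstone_def upt card_insert_if eval_nat_numeral algebra_simps)
qed

lemma wf_K2: "wf_tgraph K2"
  by (simp add: wf_tgraph_def K2_def)

lemma wf_wheatstone: "wf_tgraph wheatstone"
  by (simp add: wf_tgraph_def wheatstone_def)

section \<open>Edge-disjoint connections\<close>

text \<open>A lower bound \<open>k\<close> for the flow between the terminals. Connecting edge sets
  take the place of paths, since they compose by mere union.\<close>

definition linked :: "tgraph \<Rightarrow> nat \<Rightarrow> bool" where
  "linked G k \<longleftrightarrow> (\<exists>F :: nat \<Rightarrow> nat set. (\<forall>i<k. F i \<subseteq> edges G) \<and>
     (\<forall>i<k. joined G (F i)) \<and> (\<forall>i<k. \<forall>j<k. i \<noteq> j \<longrightarrow> F i \<inter> F j = {}))"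

lemma linked_K2: "linked K2 1"
proof -
  have "(0, 1) \<in> adj_rel K2 {0}" by (simp add: adj_rel_def K2_def)
  then show ?thesis unfolding linked_def joined_def
    by (intro exI[of _ "\<lambda>_. {0}"]) (auto simp: K2_def)
qed

lemma linked_wheatstone: "linked wheatstone 2"
proof -
  have "(0, 2) \<in> adj_rel wheatstone {0, 2}" "(2, 1) \<in> adj_rel wheatstone {0, 2}"
    "(0, 3) \<in> adj_rel wheatstone {1, 3}" "(3, 1) \<in> adj_rel wheatstone {1, 3}"
    by (auto simp: adj_rel_def wheatstone_def)
  then have "(0, 1) \<in> (adj_rel wheatstone {0, 2})\<^sup>*" "(0, 1) \<in> (adj_rel wheatstone {1, 3})\<^sup>*"
    by (meson r_into_rtrancl rtrancl.rtrancl_into_rtrancl)+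
  then show ?thesis unfolding linked_def joined_def
    \<comment> \<open>The paths 0-2-1 and 0-3-1, which avoid the middle edge.\<close>
    by (intro exI[of _ "\<lambda>i. if i = 0 then {0, 2} else {1, 3}"])
      (auto simp: wheatstone_def less_2_cases_iff)
qed

context disjoint_tgraphs
begin

lemma linked_par:
  assumes "linked G1 k" "linked G2 l"
  shows "linked (par_comp G1 G2) (k + l)"
proof -
  from assms(1) obtain F1 where
    "\<forall>i<k. F1 i \<subseteq> edges G1" "\<forall>i<k. joined G1 (F1 i)"
    "\<forall>i<k. \<forall>j<k. i \<noteq> j \<longrightarrow> F1 i \<inter> F1 j = {}"
    unfolding linked_def by blast
  note F1 = this[rule_format]
  from assms(2) obtain F2 where
    "\<forall>i<l. F2 i \<subseteq> edges G2" "\<forall>i<l. joined G2 (F2 i)"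
    "\<forall>i<l. \<forall>j<l. i \<noteq> j \<longrightarrow> F2 i \<inter> F2 j = {}"
    unfolding linked_def by blast
  note F2 = this[rule_format]
  let ?F = "\<lambda>i. if i < k then F1 i else F2 (i - k)"
  have diff: "i - k < l" if "i < k + l" "\<not> i < k" for i using that by simp
  have "?F i \<subseteq> edges (par_comp G1 G2)" if "i < k + l" for i
    using F1(1)[of i] F2(1)[OF diff, of i] that by (cases "i < k") (simp_all add: edges_par le_supI1 le_supI2)
  moreover have "joined (par_comp G1 G2) (?F i)" if "i < k + l" for i
    using joined_par[of "F1 i" "{}"] joined_par[of "{}" "F2 (i - k)"]
      F1(1,2)[of i] F2(1,2)[OF diff, of i] that
    by (cases "i < k") simp_all
  moreover have "?F i \<inter> ?F j = {}" if ij: "i < k + l" "j < k + l" "i \<noteq> j" for i j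
  proof -
    have across: "F1 i' \<inter> F2 j' = {}" if "i' < k" "j' < l" for i' j'
      using F1(1)[OF that(1)] F2(1)[OF that(2)] disjoint_edges by blast
    show ?thesis
      using ij F1(3)[of i j] F2(3)[of "i - k" "j - k"] diff[of i] diff[of j] across[of i "j - k"] across[of j "i - k"]
      by (cases "i < k"; cases "j < k") (simp_all add: Int_commute)
  qed
  ultimately show ?thesis unfolding linked_def by (intro exI[of _ ?F]) blast
qed

text \<open>The \<open>i\<close>-th connections of the two factors are joined end to end, until the
  smaller family is exhausted.\<close>

lemma linked_ser:
  assumes "linked G1 k" "linked G2 l"
  shows "linked (ser_comp G1 G2) (min k l)"
proof -
  from assms(1) obtain F1 where
    "\<forall>i<k. F1 i \<subseteq> edges G1" "\<forall>i<k. joined G1 (F1 i)"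
    "\<forall>i<k. \<forall>j<k. i \<noteq> j \<longrightarrow> F1 i \<inter> F1 j = {}"
    unfolding linked_def by blast
  note F1 = this[rule_format]
  from assms(2) obtain F2 where
    "\<forall>i<l. F2 i \<subseteq> edges G2" "\<forall>i<l. joined G2 (F2 i)"
    "\<forall>i<l. \<forall>j<l. i \<noteq> j \<longrightarrow> F2 i \<inter> F2 j = {}"
    unfolding linked_def by blast
  note F2 = this[rule_format]
  let ?F = "\<lambda>i. F1 i \<union> F2 i"
  have "?F i \<subseteq> edges (ser_comp G1 G2)" "joined (ser_comp G1 G2) (?F i)" if "i < min k l" for i
    using F1(1,2)[of i] F2(1,2)[of i] that by (auto simp: edges_ser joined_ser)
  moreover have "?F i \<inter> ?F j = {}" if ij: "i < min k l" "j < min k l" "i \<noteq> j" for i j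
  proof -
    have across: "F1 i' \<inter> F2 j' = {}" if "i' < k" "j' < l" for i' j'
      using F1(1)[OF that(1)] F2(1)[OF that(2)] disjoint_edges by blast
    show ?thesis
      using ij F1(3)[of i j] F2(3)[of i j] across[of i j] across[of j i]
      by (simp add: Int_Un_distrib Int_Un_distrib2 Int_commute)
  qed
  ultimately show ?thesis unfolding linked_def by (intro exI[of _ ?F]) blast
qed

end

section \<open>Flow bounds and embeddings\<close>

definition embeds :: "(nat \<Rightarrow> nat) \<Rightarrow> (nat \<Rightarrow> nat) \<Rightarrow> tgraph \<Rightarrow> tgraph \<Rightarrow> bool" where
  "embeds f g G H \<longleftrightarrow> inj_on f (verts G) \<and> inj_on g (edges G) \<and> f ` verts G \<subseteq> verts H \<and>
     g ` edges G \<subseteq> edges H \<and> (\<forall>e\<in>edges G. inc H (g e) = f ` inc G e)"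

lemma embeds_connected:
  assumes "embeds f g G H" "A \<subseteq> edges G" "(x, y) \<in> (adj_rel G A)\<^sup>*"
  shows "(f x, f y) \<in> (adj_rel H (g ` A))\<^sup>*"
  using assms(3)
proof induction
  case (step y z)
  then obtain e where e: "e \<in> A" "inc G e = {y, z}" by (auto simp: adj_rel_def)
  then have "inc H (g e) = {f y, f z}" using assms(1,2) by (auto simp: embeds_def)
  then have "(f y, f z) \<in> adj_rel H (g ` A)" using e(1) by (auto simp: adj_rel_def)
  with step.IH show ?case by (rule rtrancl.rtrancl_into_rtrancl)
qed simp

text \<open>The \<open>n\<close>-th connection, unlike the \<open>n\<close> earlier ones, may use the virtual adjacencies
  \<open>B\<close>; these stand for a connection through the rest of a larger graph.\<close>

definition flow_family ::
  "tgraph \<Rightarrow> (nat \<times> nat) set \<Rightarrow> nat \<Rightarrow> nat \<Rightarrow> nat \<Rightarrow> (nat \<Rightarrow> nat set) \<Rightarrow> bool" where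
  "flow_family G B x y n F \<longleftrightarrow> (\<forall>i\<le>n. F i \<subseteq> edges G) \<and>
     (\<forall>i\<le>n. \<forall>j\<le>n. i \<noteq> j \<longrightarrow> F i \<inter> F j = {}) \<and>
     (\<forall>i<n. (x, y) \<in> (adj_rel G (F i))\<^sup>*) \<and> (x, y) \<in> (adj_rel G (F n) \<union> B)\<^sup>*"

lemma flow_familyD:
  assumes "flow_family G B x y n F"
  shows "i \<le> n \<Longrightarrow> F i \<subseteq> edges G"
    and "i \<le> n \<Longrightarrow> j \<le> n \<Longrightarrow> i \<noteq> j \<Longrightarrow> F i \<inter> F j = {}"
    and "i < n \<Longrightarrow> (x, y) \<in> (adj_rel G (F i))\<^sup>*"
    and "(x, y) \<in> (adj_rel G (F n) \<union> B)\<^sup>*"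
  using assms by (simp_all add: flow_family_def)

text \<open>A family has \<open>n + 1\<close> members, one of which may use \<open>B\<close>;
  \<open>n < L\<close> thus limits their total number to \<open>L\<close>.\<close>

definition flow_bounded :: "tgraph \<Rightarrow> (nat \<times> nat) set \<Rightarrow> nat \<Rightarrow> bool" where
  "flow_bounded G B L \<longleftrightarrow>
     (\<forall>x\<in>verts G. \<forall>y\<in>verts G. x \<noteq> y \<longrightarrow> (\<forall>n F. flow_family G B x y n F \<longrightarrow> n < L))"

text \<open>Stands for something connected in parallel to \<open>G\<close>.\<close>

definition terminal_link :: "tgraph \<Rightarrow> (nat \<times> nat) set" where
  "terminal_link G = {(src G, tgt G), (tgt G, src G)}"

text \<open>A family in \<open>G\<close> is carried over to \<open>H\<close>, where the virtual
  links \<open>B\<close> are realised by edges \<open>C\<close> outside the image together with the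
  virtual links \<open>B'\<close>.\<close>

lemma flow_bounded_embeds:
  assumes bd: "flow_bounded H B' L" and emb: "embeds f g G H"
    and C: "C \<subseteq> edges H" "C \<inter> g ` edges G = {}"
    and B: "\<And>x y. (x, y) \<in> B \<Longrightarrow> (f x, f y) \<in> (adj_rel H C \<union> B')\<^sup>*"
  shows "flow_bounded G B L"
  unfolding flow_bounded_def
proof (intro ballI allI impI)
  fix x y n F assume xy: "x \<in> verts G" "y \<in> verts G" "x \<noteq> y" and fam: "flow_family G B x y n F"
  note F = flow_familyD[OF fam]
  \<comment> \<open>Only the last connection may use \<open>B\<close>, so \<open>C\<close> is spent
    once and disjointness survives.\<close>
  define F' where "F' i = (if i < n then g ` F i else g ` F n \<union> C)" for i
  have g: "inj_on g (edges G)" "g ` edges G \<subseteq> edges H" and f: "inj_on f (verts G)" "f ` verts G \<subseteq> verts H"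
    and inc: "\<And>e. e \<in> edges G \<Longrightarrow> inc H (g e) = f ` inc G e"
    using emb by (auto simp: embeds_def)
  have gF: "g ` F i \<subseteq> g ` edges G" if "i \<le> n" for i using F(1) that by blast
  have gFF: "g ` F i \<inter> g ` F j = {}" if "i \<le> n" "j \<le> n" "i \<noteq> j" for i j
    using inj_on_image_Int[OF g(1) F(1)[OF that(1)] F(1)[OF that(2)]] F(2)[OF that] by simp
  have sub: "F' i \<subseteq> edges H" if "i \<le> n" for i
    using order_trans[OF gF g(2), of i] order_trans[OF gF g(2), of n] C(1) that
    by (simp add: F'_def)
  have disj: "F' i \<inter> F' j = {}" if "i \<le> n" "j \<le> n" "i \<noteq> j" for i j
  proof -
    have gFC: "g ` F i \<inter> C = {}" "C \<inter> g ` F j = {}" using gF that C(2) by blast+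
    show ?thesis
    proof (cases "i < n")
      case True
      then show ?thesis
        using gFF[OF that] gFF[of i n] gFC that by (simp add: F'_def Int_Un_distrib)
    next
      case False
      then have "i = n" "j < n" using that by auto
      then show ?thesis
        using gFF[OF that] gFC that by (simp add: F'_def Int_Un_distrib2)
    qed
  qed
  have conn: "(f x, f y) \<in> (adj_rel H (F' i))\<^sup>*" if "i < n" for i
    using embeds_connected[OF emb F(1) F(3)] that by (simp add: F'_def)
  have Fn: "F n \<subseteq> edges G" using F(1) by simp
  have edge: "(f u, f w) \<in> (adj_rel H (F' n) \<union> B')\<^sup>*" if uw: "(u, w) \<in> adj_rel G (F n) \<union> B" for u w
  proof (cases "(u, w) \<in> B")
    case True
    have "adj_rel H C \<union> B' \<subseteq> adj_rel H (F' n) \<union> B'" by (auto simp: F'_def adj_rel_def)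
    from rtrancl_mono[OF this] B[OF True] show ?thesis by (rule subsetD)
  next
    case False
    then have "(u, w) \<in> (adj_rel G (F n))\<^sup>*" using uw by blast
    from embeds_connected[OF emb Fn this] have *: "(f u, f w) \<in> (adj_rel H (g ` F n))\<^sup>*" .
    have "adj_rel H (g ` F n) \<subseteq> adj_rel H (F' n) \<union> B'" by (auto simp: F'_def adj_rel_def)
    from rtrancl_mono[OF this] * show ?thesis by (rule subsetD)
  qed
  from F(4) have "(f x, f y) \<in> (adj_rel H (F' n) \<union> B')\<^sup>*"
  proof induction
    case (step u w)
    from step.IH edge[OF step.hyps(2)] show ?case by (rule rtrancl_trans)
  qed simp
  then have "flow_family H B' (f x) (f y) n F'"
    unfolding flow_family_def using sub disj conn by simp
  moreover have "f x \<in> verts H" "f y \<in> verts H" "f x \<noteq> f y"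
    using xy f by (auto dest: inj_onD)
  ultimately show "n < L" using bd unfolding flow_bounded_def by blast
qed

lemma linked_flow_bounded:
  assumes "wf_tgraph G" "linked G k" "flow_bounded G (terminal_link G) L"
  shows "k < L"
proof -
  obtain F where "\<forall>i<k. F i \<subseteq> edges G" "\<forall>i<k. joined G (F i)"
    "\<forall>i<k. \<forall>j<k. i \<noteq> j \<longrightarrow> F i \<inter> F j = {}"
    using assms(2) unfolding linked_def by blast
  note F = this[rule_format]
  \<comment> \<open>Connection number \<open>k\<close> consists of the virtual link alone and takes
    no edges, so there are \<open>k + 1\<close> in all.\<close>
  have "flow_family G (terminal_link G) (src G) (tgt G) k (F(k := {}))"
    unfolding flow_family_def using F by (auto simp: joined_def terminal_link_def order_le_less)
  then show ?thesis using assms(1,3) unfolding flow_bounded_def wf_tgraph_def by blast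
qed

section \<open>From connections to edge-disjoint paths\<close>

lemma is_path_of_connected:
  assumes "wf_tgraph G" "A \<subseteq> edges G" "y \<in> verts G" "(x, y) \<in> (adj_rel G A)\<^sup>*"
  shows "\<exists>vs es. is_path G x y vs es \<and> set es \<subseteq> A"
  using assms(4)
proof (induction rule: converse_rtrancl_induct)
  case base
  show ?case by (rule exI[of _ "[y]"], rule exI[of _ "[]"]) (simp add: is_path_def assms(3))
next
  case (step x z)
  then obtain vs es where p: "is_path G z y vs es" "set es \<subseteq> A" by blast
  from step(1) obtain e where e: "e \<in> A" "inc G e = {x, z}" by (auto simp: adj_rel_def)
  show ?case
  proof (cases "x \<in> set vs")
    case False
    have "inc G e \<subseteq> verts G" using e(1) assms(1,2) by (auto simp: wf_tgraph_def)
    then have "x \<in> verts G" using e(2) by simp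
    moreover have "inc G ((e # es) ! i) = {(x # vs) ! i, (x # vs) ! Suc i}"
      if "i < length (e # es)" for i
      using that e p(1) by (cases i; cases vs) (auto simp: is_path_def)
    ultimately have "is_path G x y (x # vs) (e # es)"
      using p e False assms(2) unfolding is_path_def by (cases vs) auto
    then show ?thesis using e p(2) by (metis insert_subset list.simps(15))
  next
    case True
    then obtain j where j: "j < length vs" "vs ! j = x" by (auto simp: in_set_conv_nth)
    \<comment> \<open>If \<open>x\<close> already lies on the path, the new edge is discarded and
      the path is cut to start at \<open>x\<close>; this keeps its vertices distinct.\<close>
    have "is_path G x y (drop j vs) (drop j es)"
      using p(1) j set_drop_subset[of j vs] set_drop_subset[of j es]
      unfolding is_path_def by (auto simp: hd_drop_conv_nth)
    moreover have "set (drop j es) \<subseteq> A" using p(2) set_drop_subset[of j es] by blast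
    ultimately show ?thesis by blast
  qed
qed

lemma flow_bounded_maxmaxflow:
  assumes wf: "wf_tgraph G" and "maxmaxflow G \<le> L"
  shows "flow_bounded G {} L"
  unfolding flow_bounded_def
proof (intro ballI allI impI)
  fix x y n F assume xy: "x \<in> verts G" "y \<in> verts G" "x \<noteq> y" and fam: "flow_family G {} x y n F"
  note F = flow_familyD[OF fam]
  have "\<exists>P. P \<in> path_edge_sets G x y \<and> P \<subseteq> F i \<and> P \<noteq> {}" if "i \<le> n" for i
  proof -
    have "(x, y) \<in> (adj_rel G (F i))\<^sup>*" using F(3)[of i] F(4) that by (cases "i = n") auto
    from is_path_of_connected[OF wf F(1)[OF that] xy(2) this]
    obtain vs es where p: "is_path G x y vs es" "set es \<subseteq> F i" by blast
    moreover have "es \<noteq> []" using p(1) xy(3) by (auto simp: is_path_def length_Suc_conv)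
    ultimately show ?thesis unfolding path_edge_sets_def by (intro exI[of _ "set es"]) auto
  qed
  then obtain P where P: "\<And>i. i \<le> n \<Longrightarrow> P i \<in> path_edge_sets G x y \<and> P i \<subseteq> F i \<and> P i \<noteq> {}"
    by metis
  have disj: "P i \<inter> P j = {}" if "i \<le> n" "j \<le> n" "i \<noteq> j" for i j
    using P[OF that(1)] P[OF that(2)] F(2)[OF that] by blast
  \<comment> \<open>The path edge sets are disjoint and nonempty, hence distinct; otherwise the set
    of them could have fewer than \<open>n + 1\<close> members.\<close>
  have "inj_on P {..n}"
    using disj P by (intro inj_onI) (metis Int_absorb atMost_iff)
  then have card: "card (P ` {..n}) = Suc n" by (simp add: card_image)
  have "pairwise disjnt (P ` {..n})"
    using disj unfolding pairwise_def disjnt_def by auto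
  moreover have sub: "path_edge_sets G x y \<subseteq> Pow (edges G)" for x y
    by (auto simp: path_edge_sets_def is_path_def)
  moreover have fin: "finite (edges G)" "finite (verts G)" using wf by (auto simp: wf_tgraph_def)
  have "finite {card F |F. F \<subseteq> path_edge_sets G x y \<and> pairwise disjnt F}"
  proof (rule finite_subset)
    show "{card F |F. F \<subseteq> path_edge_sets G x y \<and> pairwise disjnt F} \<subseteq> card ` Pow (Pow (edges G))"
      using sub by blast
  qed (use fin in auto)
  moreover have "Suc n \<in> {card F |F. F \<subseteq> path_edge_sets G x y \<and> pairwise disjnt F}"
    using calculation(1) card P by (auto intro!: exI[of _ "P ` {..n}"])
  ultimately have 1: "Suc n \<le> local_edge_conn G x y"
    unfolding local_edge_conn_def by (intro Max_ge)
  have "{local_edge_conn G x y |x y. x \<in> verts G \<and> y \<in> verts G \<and> x \<noteq> y} \<subseteq>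
      (\<lambda>(x, y). local_edge_conn G x y) ` (verts G \<times> verts G)" by auto
  then have "finite {local_edge_conn G x y |x y. x \<in> verts G \<and> y \<in> verts G \<and> x \<noteq> y}"
    using fin by (meson finite_SigmaI finite_imageI finite_subset)
  then have "local_edge_conn G x y \<le> maxmaxflow G"
    unfolding maxmaxflow_def using xy by (intro Max_ge) auto
  with 1 assms(2) show "n < L" by simp
qed

lemma rtrancl_sym: "sym R \<Longrightarrow> (x, y) \<in> R\<^sup>* \<Longrightarrow> (y, x) \<in> R\<^sup>*"
  using sym_rtrancl by (auto dest: symD)

lemma linked_joined_edges:
  assumes "linked G k" "k \<ge> 1"
  shows "joined G (edges G)"
proof -
  obtain F where F: "\<forall>i<k. F i \<subseteq> edges G" "\<forall>i<k. joined G (F i)"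
    using assms(1) unfolding linked_def by blast
  define A where "A = F 0"
  have A: "A \<subseteq> edges G" "joined G A" using F assms(2) by (auto simp: A_def)
  then have "adj_rel G A \<subseteq> adj_rel G (edges G)" by (auto simp: adj_rel_def)
  from rtrancl_mono[OF this] A(2) show ?thesis unfolding joined_def by (rule subsetD)
qed

section \<open>Invariance under isomorphism\<close>

locale tgraph_isomorphism =
  fixes G H :: tgraph and f g :: "nat \<Rightarrow> nat"
  assumes wfG: "wf_tgraph G"
    and bij_f: "bij_betw f (verts G) (verts H)" and bij_g: "bij_betw g (edges G) (edges H)"
    and inc_g: "\<And>e. e \<in> edges G \<Longrightarrow> inc H (g e) = f ` inc G e"
    and src_f: "f (src G) = src H" and tgt_f: "f (tgt G) = tgt H"
begin

lemma embeds: "embeds f g G H"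
  using bij_f bij_g inc_g by (auto simp: embeds_def bij_betw_def)

lemma terminals: "src G \<in> verts G" "tgt G \<in> verts G" "src G \<noteq> tgt G"
  using wfG by (auto simp: wf_tgraph_def)

lemma verts_H: "verts H = f ` verts G" and edges_H: "edges H = g ` edges G"
  and inj_f: "inj_on f (verts G)" and inj_g: "inj_on g (edges G)"
  using bij_f bij_g by (auto simp: bij_betw_def)

lemma inc_subset: "e \<in> edges G \<Longrightarrow> inc G e \<subseteq> verts G"
  and card_inc: "e \<in> edges G \<Longrightarrow> card (inc G e) = 2"
  using wfG by (auto simp: wf_tgraph_def)

lemma wf_H: "wf_tgraph H"
proof -
  have "inc H e \<subseteq> verts H \<and> card (inc H e) = 2" if "e \<in> edges H" for e
  proof -
    from that obtain e' where e': "e' \<in> edges G" "e = g e'" by (auto simp: edges_H)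
    then show ?thesis
      using inc_subset[OF e'(1)] card_inc[OF e'(1)] inj_f
      by (simp add: inc_g verts_H image_mono card_image inj_on_subset)
  qed
  moreover have "finite (verts H)" "finite (edges H)"
    using wfG by (auto simp: verts_H edges_H wf_tgraph_def)
  moreover have "src H \<in> verts H" "tgt H \<in> verts H" "src H \<noteq> tgt H"
    using terminals inj_f by (auto simp: verts_H simp flip: src_f tgt_f dest: inj_onD)
  ultimately show ?thesis by (simp add: wf_tgraph_def)
qed

lemma adj_rel_H:
  assumes "A \<subseteq> edges G"
  shows "adj_rel H (g ` A) = map_prod f f ` adj_rel G A"
proof (intro equalityI subsetI)
  fix z assume "z \<in> adj_rel H (g ` A)"
  then obtain x y e where z: "z = (x, y)" and e: "e \<in> A" "inc H (g e) = {x, y}"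
    by (auto simp: adj_rel_def)
  have eG: "e \<in> edges G" using e(1) assms by blast
  obtain a b where ab: "inc G e = {a, b}" using card_inc[OF eG] unfolding card_2_iff by blast
  have "{f a, f b} = {x, y}" using e(2) inc_g[OF eG] ab by simp
  then have "inc G e = {a, b} \<and> f a = x \<and> f b = y \<or> inc G e = {b, a} \<and> f b = x \<and> f a = y"
    using ab by (auto simp: doubleton_eq_iff)
  then show "z \<in> map_prod f f ` adj_rel G A"
    using e(1) unfolding z adj_rel_def by (auto simp: image_iff)
next
  fix z assume "z \<in> map_prod f f ` adj_rel G A"
  then obtain a b e where e: "z = (f a, f b)" "e \<in> A" "inc G e = {a, b}"
    by (auto simp: adj_rel_def)
  moreover from this have "inc H (g e) = {f a, f b}" using inc_g assms by auto
  ultimately show "z \<in> adj_rel H (g ` A)" unfolding adj_rel_def by blast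
qed

text \<open>An isomorphism is a quotient map with trivial fibres, so the quotient lemmas apply with
  \<open>K\<close> equal to \<open>R\<close>.\<close>

lemma
  assumes "A \<subseteq> edges G"
  shows num_comp_H: "num_comp H (g ` A) = num_comp G A"
    and joined_H: "joined H (g ` A) \<longleftrightarrow> joined G A"
proof -
  have 1: "(x, y) \<in> (adj_rel G A)\<^sup>*" if "x \<in> verts G" "y \<in> verts G" "f x = f y" for x y
    using inj_onD[OF inj_f that(3,1,2)] by simp
  show "num_comp H (g ` A) = num_comp G A"
    unfolding num_comp_eq_num_classes adj_rel_H[OF assms] verts_H
    by (rule num_classes_map_prod[OF _ order_refl adj_rel_subset[OF wfG assms] 1 sym_adj_rel]) simp
  show "joined H (g ` A) \<longleftrightarrow> joined G A"
    unfolding joined_def adj_rel_H[OF assms] src_f[symmetric] tgt_f[symmetric]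
    by (rule rtrancl_map_prod_iff[OF _ order_refl adj_rel_subset[OF wfG assms] 1 terminals(1,2)]) simp
qed

lemma weight_H: "A \<subseteq> edges G \<Longrightarrow> weight H q (g ` A) = weight G q A"
  using inj_g by (simp add: weight_def num_comp_H card_image inj_on_subset)

lemma bij_Pow: "bij_betw ((`) g) (Pow (edges G)) (Pow (edges H))"
  by (rule bij_betw_Pow[OF bij_g])

lemma chrom_poly_H: "chrom_poly H q = chrom_poly G q"
  unfolding chrom_poly_eq_sum_weight sum.reindex_bij_betw[OF bij_Pow, symmetric]
  by (intro sum.cong refl) (simp add: weight_H)

lemma conn_poly_H: "conn_poly H q = conn_poly G q"
  unfolding conn_poly_def sum.reindex_bij_betw[OF bij_Pow, symmetric]
  by (intro sum.cong refl) (simp add: weight_H joined_H)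

lemma linked_H:
  assumes "linked G k"
  shows "linked H k"
proof -
  obtain F where "\<forall>i<k. F i \<subseteq> edges G" "\<forall>i<k. joined G (F i)"
    "\<forall>i<k. \<forall>j<k. i \<noteq> j \<longrightarrow> F i \<inter> F j = {}"
    using assms unfolding linked_def by blast
  note F = this[rule_format]
  have "g ` F i \<inter> g ` F j = {}" if "i < k" "j < k" "i \<noteq> j" for i j
    using inj_on_image_Int[OF inj_g F(1)[OF that(1)] F(1)[OF that(2)]] F(3)[OF that] by simp
  then show ?thesis unfolding linked_def
    by (intro exI[of _ "\<lambda>i. g ` F i"]) (simp add: F(1,2) joined_H edges_H image_mono)
qed

lemma flow_bounded_G:
  shows "flow_bounded H {} L \<Longrightarrow> flow_bounded G {} L"
    and "flow_bounded H (terminal_link H) L \<Longrightarrow> flow_bounded G (terminal_link G) L"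
proof -
  assume "flow_bounded H {} L"
  from flow_bounded_embeds[OF this embeds, of "{}" "{}"] show "flow_bounded G {} L" by simp
next
  assume "flow_bounded H (terminal_link H) L"
  then show "flow_bounded G (terminal_link G) L"
    by (rule flow_bounded_embeds[OF _ embeds, of _ _ "{}"])
      (auto simp: terminal_link_def src_f tgt_f)
qed

end

section \<open>Flow bounds inherited by the factors of a composition\<close>

context disjoint_tgraphs
begin

lemma embeds_glue:
  shows "(\<And>x. x \<in> verts G1 \<Longrightarrow> r x = x) \<Longrightarrow> embeds r (\<lambda>e. e) G1 (glue r s t)"
    and "inj_on r (verts G2) \<Longrightarrow> embeds r (\<lambda>e. e) G2 (glue r s t)"
  using disjoint_edges by (auto simp: embeds_def glue_def inj_on_def intro: rev_image_eqI)

lemma embeds_par: "embeds par_map (\<lambda>e. e) G1 (par_comp G1 G2)" "embeds par_map (\<lambda>e. e) G2 (par_comp G1 G2)"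
  and embeds_ser: "embeds ser_map (\<lambda>e. e) G1 (ser_comp G1 G2)" "embeds ser_map (\<lambda>e. e) G2 (ser_comp G1 G2)"
  unfolding par_comp_eq ser_comp_eq
  by (intro embeds_glue inj_on_par_map inj_on_ser_map par_map_eq ser_map_eq; assumption)+

lemma maps_terminals:
  "par_map (src G1) = src G1" "par_map (tgt G1) = tgt G1"
  "par_map (src G2) = src G1" "par_map (tgt G2) = tgt G1"
  "ser_map (src G1) = src G1" "ser_map (tgt G1) = tgt G1"
  "ser_map (src G2) = tgt G1" "ser_map (tgt G2) = tgt G2"
  using terminals not_in_both by (auto simp: par_map_def ser_map_def)

lemma comp_terminals:
  "src (par_comp G1 G2) = src G1" "tgt (par_comp G1 G2) = tgt G1"
  "src (ser_comp G1 G2) = src G1" "tgt (ser_comp G1 G2) = tgt G2"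
  by (simp_all add: par_comp_eq ser_comp_eq glue_def)

lemma sym_terminal_link: "sym (adj_rel G A \<union> terminal_link G')"
  using sym_adj_rel[of G A] by (auto simp: sym_def terminal_link_def)

text \<open>The terminals are shared, so an outside connection serves each factor directly and no
  edges of the other factor are consumed.\<close>

lemma flow_bounded_par_link:
  assumes "flow_bounded (par_comp G1 G2) (terminal_link (par_comp G1 G2)) L"
  shows "flow_bounded G1 (terminal_link G1) L" "flow_bounded G2 (terminal_link G2) L"
proof -
  show "flow_bounded G1 (terminal_link G1) L"
    by (rule flow_bounded_embeds[OF assms embeds_par(1), of "{}"])
      (auto simp: terminal_link_def maps_terminals comp_terminals)
  show "flow_bounded G2 (terminal_link G2) L"
    by (rule flow_bounded_embeds[OF assms embeds_par(2), of "{}"])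
      (auto simp: terminal_link_def maps_terminals comp_terminals)
qed

text \<open>Even with nothing outside, each factor is connected in parallel to the other, whose
  edges realise the virtual link.\<close>

lemma flow_bounded_par:
  assumes "flow_bounded (par_comp G1 G2) {} L"
  shows "joined G2 (edges G2) \<Longrightarrow> flow_bounded G1 (terminal_link G1) L"
    and "joined G1 (edges G1) \<Longrightarrow> flow_bounded G2 (terminal_link G2) L"
proof -
  let ?P = "par_comp G1 G2"
  assume "joined G2 (edges G2)"
  then have "(src G1, tgt G1) \<in> (adj_rel ?P (edges G2))\<^sup>*"
    using joined_par[of "{}" "edges G2"] by (simp add: joined_def comp_terminals)
  moreover from this have "(tgt G1, src G1) \<in> (adj_rel ?P (edges G2))\<^sup>*" by (simp add: conn_sym)
  ultimately show "flow_bounded G1 (terminal_link G1) L"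
    using disjoint_edges
    by (intro flow_bounded_embeds[OF assms embeds_par(1), of "edges G2"])
      (auto simp: terminal_link_def maps_terminals edges_par)
next
  let ?P = "par_comp G1 G2"
  assume "joined G1 (edges G1)"
  then have "(src G1, tgt G1) \<in> (adj_rel ?P (edges G1))\<^sup>*"
    using joined_par[of "edges G1" "{}"] by (simp add: joined_def comp_terminals)
  moreover from this have "(tgt G1, src G1) \<in> (adj_rel ?P (edges G1))\<^sup>*" by (simp add: conn_sym)
  ultimately show "flow_bounded G2 (terminal_link G2) L"
    using disjoint_edges
    by (intro flow_bounded_embeds[OF assms embeds_par(2), of "edges G1"])
      (auto simp: terminal_link_def maps_terminals edges_par)
qed

lemma flow_bounded_ser:
  assumes "flow_bounded (ser_comp G1 G2) {} L"
  shows "flow_bounded G1 {} L" "flow_bounded G2 {} L"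
  using flow_bounded_embeds[OF assms embeds_ser(1), of "{}" "{}"]
    flow_bounded_embeds[OF assms embeds_ser(2), of "{}" "{}"] by simp_all

text \<open>The virtual link of one factor is realised by going round: through the outside link and
  then through the other factor.\<close>

lemma flow_bounded_ser_link:
  assumes "flow_bounded (ser_comp G1 G2) (terminal_link (ser_comp G1 G2)) L"
  shows "joined G2 (edges G2) \<Longrightarrow> flow_bounded G1 (terminal_link G1) L"
    and "joined G1 (edges G1) \<Longrightarrow> flow_bounded G2 (terminal_link G2) L"
proof -
  let ?S = "ser_comp G1 G2"
  let ?link = "terminal_link ?S"
  have link: "(src G1, tgt G2) \<in> ?link" by (simp add: terminal_link_def comp_terminals)
  {
    assume "joined G2 (edges G2)"
    let ?R = "adj_rel ?S (edges G2) \<union> ?link"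
    have "(tgt G1, tgt G2) \<in> (adj_rel ?S (edges G2))\<^sup>*"
      using embeds_connected[OF embeds_ser(2) order_refl] \<open>joined G2 (edges G2)\<close>
      by (fastforce simp: joined_def maps_terminals)
    then have "(tgt G1, tgt G2) \<in> ?R\<^sup>*" using rtrancl_mono[of "adj_rel ?S (edges G2)" ?R] by blast
    then have "(tgt G2, tgt G1) \<in> ?R\<^sup>*" by (rule rtrancl_sym[OF sym_terminal_link])
    then have 1: "(src G1, tgt G1) \<in> ?R\<^sup>*" using link by (meson UnI2 converse_rtrancl_into_rtrancl)
    then have "(tgt G1, src G1) \<in> ?R\<^sup>*" by (rule rtrancl_sym[OF sym_terminal_link])
    with 1 show "flow_bounded G1 (terminal_link G1) L"
      using disjoint_edges
      by (intro flow_bounded_embeds[OF assms embeds_ser(1), of "edges G2"])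
        (auto simp: terminal_link_def[of G1] maps_terminals edges_ser)
  }
  {
    assume "joined G1 (edges G1)"
    let ?R = "adj_rel ?S (edges G1) \<union> ?link"
    have "(src G1, tgt G1) \<in> (adj_rel ?S (edges G1))\<^sup>*"
      using embeds_connected[OF embeds_ser(1) order_refl] \<open>joined G1 (edges G1)\<close>
      by (fastforce simp: joined_def maps_terminals)
    then have "(src G1, tgt G1) \<in> ?R\<^sup>*" using rtrancl_mono[of "adj_rel ?S (edges G1)" ?R] by blast
    then have "(tgt G1, src G1) \<in> ?R\<^sup>*" by (rule rtrancl_sym[OF sym_terminal_link])
    then have 1: "(tgt G1, tgt G2) \<in> ?R\<^sup>*" using link by (meson UnI2 rtrancl.rtrancl_into_rtrancl)
    then have "(tgt G2, tgt G1) \<in> ?R\<^sup>*" by (rule rtrancl_sym[OF sym_terminal_link])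
    with 1 show "flow_bounded G2 (terminal_link G2) L"
      using disjoint_edges
      by (intro flow_bounded_embeds[OF assms embeds_ser(2), of "edges G1"])
        (auto simp: terminal_link_def[of G2] maps_terminals edges_ser)
  }
qed

end

section \<open>Discs of transmissivities\<close>

text \<open>For \<open>e = 1 / R\<close> the left side is \<open>2 * ln g\<close>. The right side
  minus the left vanishes at 0, and its derivative is a nonnegative multiple of
  \<open>1 - 2 * x\<^sup>2\<close> there.\<close>

lemma ln_quotient_le:
  fixes e :: real
  assumes "0 \<le> e" "e \<le> 1 / 2"
  shows "ln (1 + e) - ln (1 - e + 2 * e\<^sup>2) \<le> 2 * (e - e\<^sup>2)"
proof -
  have pos: "0 < 1 - x + 2 * x\<^sup>2" for x :: real
  proof -
    have "1 - x + 2 * x\<^sup>2 = (1 - x / 2)\<^sup>2 + 7 / 4 * x\<^sup>2"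
      by (simp add: power2_eq_square algebra_simps)
    then show ?thesis by (cases "x = 0") (simp_all add: add_nonneg_pos)
  qed
  define \<phi> where "\<phi> x = 2 * (x - x\<^sup>2) - ln (1 + x) + ln (1 - x + 2 * x\<^sup>2)" for x :: real
  have "\<phi> 0 \<le> \<phi> e"
  proof (rule DERIV_nonneg_imp_nondecreasing[OF assms(1)])
    fix x assume x: "0 \<le> x" "x \<le> e"
    let ?d = "2 * (1 - 2 * x) - 1 / (1 + x) + (4 * x - 1) / (1 - x + 2 * x\<^sup>2)"
    have "(\<phi> has_real_derivative ?d) (at x)"
      unfolding \<phi>_def using x pos[of x]
      by (auto intro!: derivative_eq_intros simp: divide_inverse)
    moreover have "?d = 4 * x\<^sup>2 * (1 - 2 * x\<^sup>2) / ((1 + x) * (1 - x + 2 * x\<^sup>2))"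
      using x pos[of x] by (simp add: field_simps power2_eq_square)
    moreover have "2 * x\<^sup>2 \<le> 1"
      using power_mono[of x "1 / 2" 2] x assms by (simp add: power2_eq_square)
    ultimately show "\<exists>y. (\<phi> has_real_derivative y) (at x) \<and> 0 \<le> y"
      using x pos[of x] by (intro exI[of _ ?d]) simp
  qed
  then show ?thesis by (simp add: \<phi>_def)
qed

text \<open>The Taylor polynomial minus the logarithm vanishes at 0 and has derivative
  \<open>x ^ 3 / (1 + x)\<close>.\<close>

lemma ln_one_plus_le_cubic:
  fixes e :: real
  assumes "0 \<le> e"
  shows "ln (1 + e) \<le> e - e\<^sup>2 / 2 + e ^ 3 / 3"
proof -
  define \<phi> where "\<phi> x = x - x\<^sup>2 / 2 + x ^ 3 / 3 - ln (1 + x)" for x :: real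
  have "\<phi> 0 \<le> \<phi> e"
  proof (rule DERIV_nonneg_imp_nondecreasing[OF assms(1)])
    fix x assume x: "0 \<le> x" "x \<le> e"
    let ?d = "1 - x + x\<^sup>2 - 1 / (1 + x)"
    have "(\<phi> has_real_derivative ?d) (at x)"
      unfolding \<phi>_def using x
      by (auto intro!: derivative_eq_intros)
    moreover have "?d = x ^ 3 / (1 + x)"
      using x by (simp add: field_simps power2_eq_square power3_eq_cube)
    ultimately show "\<exists>y. (\<phi> has_real_derivative y) (at x) \<and> 0 \<le> y"
      using x by (intro exI[of _ ?d]) simp
  qed
  then show ?thesis by (simp add: \<phi>_def)
qed

text \<open>For \<open>e = 1 / R\<close> the first factor is \<open>(R + 1) * ln 2 - 1\<close>,
  which bounds every \<open>k < L\<close>, and the right side is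
  \<open>2 * ln (2 * R / (R + 1))\<close>. This is the estimate behind
  \<open>g_power_le\<close>.\<close>

lemma growth_exponent_bound:
  fixes e :: real
  assumes "0 < e" "e \<le> 1 / 2"
  shows "((1 / e + 1) * ln 2 - 1) * (ln (1 + e) - ln (1 - e + 2 * e\<^sup>2)) \<le> 2 * (ln 2 - ln (1 + e))"
proof -
  have "1 / e \<ge> 2" using assms by (simp add: field_simps)
  \<comment> \<open>Makes the first factor nonnegative, so that the bound on the logarithms may be
    multiplied by it.\<close>
  then have "(1 / e + 1) * ln 2 \<ge> 3 * (2 / 3)"
    using ln2_ge_two_thirds by (intro mult_mono) auto
  then have "((1 / e + 1) * ln 2 - 1) * (ln (1 + e) - ln (1 - e + 2 * e\<^sup>2)) \<le>
      ((1 / e + 1) * ln 2 - 1) * (2 * (e - e\<^sup>2))"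
    using ln_quotient_le[of e] assms by (intro mult_left_mono) auto
  also have "\<dots> = 2 * (ln 2 - (e - e\<^sup>2 * (1 - ln 2)))"
    using assms by (simp add: field_simps power2_eq_square)
  also have "\<dots> \<le> 2 * (ln 2 - ln (1 + e))"
  proof -
    \<comment> \<open>The coefficients of \<open>e\<^sup>2\<close> fit exactly:
      \<open>1 / 2 - 1 / 6 = 1 - 2 / 3\<close>, with \<open>2 / 3\<close> as the lower bound for
      \<open>ln 2\<close>.\<close>
    have "e ^ 3 \<le> e\<^sup>2 / 2"
      using mult_left_mono[OF assms(2), of "e\<^sup>2"] by (simp add: power2_eq_square power3_eq_cube)
    moreover have "e\<^sup>2 * (2 / 3) \<le> e\<^sup>2 * ln 2"
      using ln2_ge_two_thirds by (intro mult_left_mono) auto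
    ultimately have "e - e\<^sup>2 / 2 + e ^ 3 / 3 \<le> e - e\<^sup>2 * (1 - ln 2)"
      by (simp add: algebra_simps)
    then show ?thesis using ln_one_plus_le_cubic[of e] assms by simp
  qed
  finally show ?thesis .
qed

section \<open>Radii of the discs for \<open>q\<close> outside the claimed bound\<close>

locale outside_disc =
  fixes q :: complex and L :: nat
  assumes L_ge_3: "L \<ge> 3" and outside: "(real L - ln 2) / ln 2 \<le> cmod (q - 1)"
begin

definition R :: real where "R = cmod (q - 1)"

text \<open>The solution of
  \<open>(g\<^sup>2 - 1) / (R - g\<^sup>2) = 2 / (R * (R - 1))\<close>.\<close>

definition g :: real where "g = sqrt (R * (R + 1) / (R\<^sup>2 - R + 2))"

definition disc :: "nat \<Rightarrow> complex set" where
  "disc k = insert (- 1 / (q - 1)) {t. cmod t \<le> (g ^ k - 1) / (R - g ^ k)}"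

lemma L_le: "real L \<le> (R + 1) * ln 2"
  using outside by (simp add: R_def field_simps)

text \<open>Otherwise \<open>(R + 1) * ln 2 < 3\<close>, contrary to
  \<open>L \<ge> 3\<close>.\<close>

lemma R_gt_2: "R > 2"
proof (rule ccontr)
  assume "\<not> R > 2"
  then have "(R + 1) * ln 2 < 3 * (1 :: real)"
    using ln_2_less_1 by (intro mult_le_less_imp_less) (auto simp: R_def intro: add_nonneg_pos)
  then show False using L_le L_ge_3 by simp
qed

lemma denom_pos: "R\<^sup>2 - R + 2 > 0"
proof -
  have "R\<^sup>2 - R + 2 = (R - 1)\<^sup>2 + (R + 1)" by (simp add: power2_eq_square algebra_simps)
  also have "\<dots> > 0" using R_gt_2 by (intro add_nonneg_pos) auto
  finally show ?thesis .
qed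

lemma g_sq: "g\<^sup>2 = R * (R + 1) / (R\<^sup>2 - R + 2)"
  unfolding g_def using R_gt_2 denom_pos by simp

text \<open>Equivalent to the disc for \<open>k = 1\<close> having radius at least
  \<open>1 / R\<^sup>2\<close>. After squaring, the difference is a multiple of
  \<open>(R - 1)\<^sup>2\<close>.\<close>

lemma g_ge: "(R\<^sup>2 + R) / (R\<^sup>2 + 1) \<le> g"
proof -
  have "(R\<^sup>2 + R)\<^sup>2 * (R\<^sup>2 - R + 2) \<le> R * (R + 1) * (R\<^sup>2 + 1)\<^sup>2"
  proof -
    have "R * (R + 1) * (R\<^sup>2 + 1)\<^sup>2 - (R\<^sup>2 + R)\<^sup>2 * (R\<^sup>2 - R + 2) = R * (R + 1) * (R - 1)\<^sup>2"
      by (simp add: power2_eq_square algebra_simps)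
    moreover have "\<dots> \<ge> 0" using R_gt_2 by simp
    ultimately show ?thesis by linarith
  qed
  moreover have "0 < (R\<^sup>2 + 1)\<^sup>2" by (intro zero_less_power add_nonneg_pos) auto
  ultimately have "((R\<^sup>2 + R) / (R\<^sup>2 + 1))\<^sup>2 \<le> R * (R + 1) / (R\<^sup>2 - R + 2)"
    using denom_pos by (simp add: power_divide divide_simps mult.commute)
  then show ?thesis unfolding g_def by (rule real_le_rsqrt)
qed

lemma g_ge_1: "g \<ge> 1"
proof -
  have "1 \<le> (R\<^sup>2 + R) / (R\<^sup>2 + 1)" using R_gt_2 by (simp add: add_nonneg_pos)
  with g_ge show ?thesis by simp
qed

text \<open>The bound is the value of \<open>Y\<close> at which
  \<open>(Y - 1) / (R - Y) = 1 / R\<close>; logarithms reduce the claim to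
  \<open>growth_exponent_bound\<close>.\<close>

lemma g_power_le:
  assumes "k < L"
  shows "g ^ k \<le> 2 * R / (R + 1)"
proof -
  define e where "e = 1 / R"
  have e: "0 < e" "e \<le> 1 / 2" using R_gt_2 by (auto simp: e_def field_simps)
  have "2 * ln g = ln (g\<^sup>2)" using g_ge_1 by (simp add: ln_realpow)
  also have "g\<^sup>2 = (1 + e) / (1 - e + 2 * e\<^sup>2)"
  proof -
    have "1 + e = (R + 1) / R" "1 - e + 2 * e\<^sup>2 = (R\<^sup>2 - R + 2) / R\<^sup>2"
      unfolding e_def using R_gt_2 by (simp_all add: field_simps power2_eq_square)
    then show ?thesis unfolding g_sq using R_gt_2 by (simp add: power2_eq_square)
  qed
  also have "ln \<dots> = ln (1 + e) - ln (1 - e + 2 * e\<^sup>2)"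
    using e by (intro ln_divide_pos add_pos_nonneg) auto
  finally have ln_g: "2 * ln g = ln (1 + e) - ln (1 - e + 2 * e\<^sup>2)" .
  \<comment> \<open>Here \<open>k < L\<close> is used as \<open>k \<le> L - 1\<close>; the one
    gained is needed in \<open>growth_exponent_bound\<close>.\<close>
  have "real k \<le> (1 / e + 1) * ln 2 - 1"
    using L_le assms by (simp add: e_def)
  then have "real k * (2 * ln g) \<le> ((1 / e + 1) * ln 2 - 1) * (2 * ln g)"
    using g_ge_1 by (intro mult_right_mono) auto
  also have "\<dots> \<le> 2 * (ln 2 - ln (1 + e))"
    unfolding ln_g by (rule growth_exponent_bound[OF e])
  finally have "ln (g ^ k) \<le> ln 2 - ln (1 + e)"
    using g_ge_1 by (simp add: ln_realpow)
  also have "\<dots> = ln (2 / (1 + e))" using e by (simp add: ln_div)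
  also have "2 / (1 + e) = 2 * R / (R + 1)" unfolding e_def using R_gt_2 by (simp add: field_simps)
  finally show ?thesis using g_ge_1 R_gt_2 by (subst (asm) ln_le_cancel_iff) auto
qed

lemma g_power_bounds:
  assumes "k < L"
  shows "1 \<le> g ^ k" "g ^ k < R" "(g ^ k - 1) / (R - g ^ k) \<le> 1 / R"
proof -
  show "1 \<le> g ^ k" using g_ge_1 by (rule one_le_power)
  have "2 * R / (R + 1) < R" using R_gt_2 by (simp add: field_simps)
  then show "g ^ k < R" using g_power_le[OF assms] by simp
  moreover have "g ^ k * (R + 1) \<le> 2 * R" using g_power_le[OF assms] R_gt_2 by (simp add: field_simps)
  ultimately show "(g ^ k - 1) / (R - g ^ k) \<le> 1 / R" using R_gt_2 by (simp add: field_simps)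
qed

lemma norm_disc: "k < L \<Longrightarrow> t \<in> disc k \<Longrightarrow> cmod t \<le> 1 / R"
  using g_power_bounds(3)[of k] by (auto simp: disc_def R_def norm_divide)

text \<open>Both factors have modulus at most \<open>1 / R\<close>, and \<open>1 / R\<^sup>2\<close>
  fits into every disc from \<open>m = 1\<close> on.\<close>

lemma mult_in_disc:
  assumes "k < L" "l < L" "m < L" "m \<ge> 1" "t \<in> disc k" "u \<in> disc l"
  shows "t * u \<in> disc m"
proof -
  have "cmod (t * u) \<le> 1 / R * (1 / R)"
    unfolding norm_mult using norm_disc assms R_gt_2 by (intro mult_mono) auto
  also have "\<dots> \<le> (g ^ m - 1) / (R - g ^ m)"
  proof -
    have "g ^ 1 \<le> g ^ m" using assms(4) g_ge_1 by (rule power_increasing)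
    then have "(R\<^sup>2 + R) / (R\<^sup>2 + 1) \<le> g ^ m" using g_ge by simp
    then have "R\<^sup>2 + R \<le> g ^ m * (R\<^sup>2 + 1)" by (simp add: divide_le_eq add_nonneg_pos)
    then show ?thesis using R_gt_2 g_power_bounds(2)[OF assms(3)]
      by (simp add: field_simps power2_eq_square)
  qed
  finally show ?thesis by (simp add: disc_def)
qed

lemma mult_disc_denom:
  assumes "k < L" "l < L" "t \<in> disc k" "u \<in> disc l"
  shows "1 + (q - 1) * (t * u) \<noteq> 0"
proof
  assume "1 + (q - 1) * (t * u) = 0"
  then have "1 = cmod ((q - 1) * (t * u))"
    by (metis add.commute add_eq_0_iff norm_minus_cancel norm_one)
  also have "\<dots> \<le> R * (1 / R * (1 / R))"
    unfolding norm_mult R_def[symmetric]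
    using norm_disc assms R_gt_2 by (intro mult_mono) auto
  also have "\<dots> < 1" using R_gt_2 by simp
  finally show False by simp
qed

text \<open>With \<open>c(Y) = (Y - 1) / (R - Y)\<close>, multiplication of \<open>Y\<close> turns into the parallel law for
  \<open>q - 1 = - R\<close> and \<open>t = - c(Y)\<close>, which is the extremal case.\<close>

lemma parallel_law_radius:
  fixes Y Z :: real
  assumes "Y < R" "Z < R"
  defines "c \<equiv> (Y - 1) / (R - Y)" and "d \<equiv> (Z - 1) / (R - Z)"
  shows "c + d + (R + 1) * (c * d) = (R - 1) * (Y * Z - 1) / ((R - Y) * (R - Z))"
    and "1 - R * (c * d) = (R - 1) * (R - Y * Z) / ((R - Y) * (R - Z))"
proof -
  \<comment> \<open>With \<open>a = R - Y\<close> and \<open>b = R - Z\<close> the denominators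
    become atoms that can be cleared.\<close>
  have "(R - a - 1) / a + (R - b - 1) / b + (R + 1) * ((R - a - 1) / a * ((R - b - 1) / b)) =
      (R - 1) * ((R - a) * (R - b) - 1) / (a * b)"
    "1 - R * ((R - a - 1) / a * ((R - b - 1) / b)) = (R - 1) * (R - (R - a) * (R - b)) / (a * b)"
    if "a \<noteq> 0" "b \<noteq> 0" for a b
    using that by (simp_all add: field_simps)
  from this[of "R - Y" "R - Z"] assms(1,2)
  show "c + d + (R + 1) * (c * d) = (R - 1) * (Y * Z - 1) / ((R - Y) * (R - Z))"
    and "1 - R * (c * d) = (R - 1) * (R - Y * Z) / ((R - Y) * (R - Z))"
    by (simp_all add: c_def d_def)
qed

text \<open>Numerator and denominator share the factor \<open>1 - u\<close>, which is nonzero by the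
  bound on \<open>u\<close>; so the value of an edge is absorbing.\<close>

lemma parallel_edge:
  assumes "cmod u < 1"
  shows "(- 1 / (q - 1) + u + (q - 2) * (- 1 / (q - 1) * u)) / (1 + (q - 1) * (- 1 / (q - 1) * u)) =
    - 1 / (q - 1)"
proof -
  define Q where "Q = q - 1"
  have q: "q - 2 = Q - 1" "Q \<noteq> 0" using R_gt_2 by (auto simp: Q_def R_def)
  have u: "1 - u \<noteq> 0" using assms by auto
  have "- 1 / Q + u + (Q - 1) * (- 1 / Q * u) = - 1 / Q * (1 - u)"
    using q(2) by (simp add: field_simps)
  moreover have "1 + Q * (- 1 / Q * u) = 1 - u" using q(2) by simp
  ultimately show ?thesis using u unfolding q(1) Q_def[symmetric] by simp
qed

lemma parallel_in_disc:
  assumes kl: "k + l < L" and t: "t \<in> disc k" and u: "u \<in> disc l"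
  shows "(t + u + (q - 2) * (t * u)) / (1 + (q - 1) * (t * u)) \<in> disc (k + l)"
proof -
  have k: "k < L" and l: "l < L" using kl by auto
  have lt1: "1 / R < 1" using R_gt_2 by simp
  consider "t = - 1 / (q - 1)" | "u = - 1 / (q - 1)" |
    "cmod t \<le> (g ^ k - 1) / (R - g ^ k)" "cmod u \<le> (g ^ l - 1) / (R - g ^ l)"
    using t u by (auto simp: disc_def)
  then show ?thesis
  proof cases
    case 1
    then show ?thesis
      using parallel_edge[of u] norm_disc[OF l u] lt1 by (simp add: disc_def)
  next
    case 2
    then show ?thesis
      using parallel_edge[of t] norm_disc[OF k t] lt1 by (simp add: disc_def add.commute mult.commute)
  next
    case 3
    define c d where "c = (g ^ k - 1) / (R - g ^ k)" and "d = (g ^ l - 1) / (R - g ^ l)"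
    note bk = g_power_bounds[OF k] and bl = g_power_bounds[OF l] and bkl = g_power_bounds[OF kl]
    have law: "c + d + (R + 1) * (c * d) =
        (R - 1) * (g ^ (k + l) - 1) / ((R - g ^ k) * (R - g ^ l))"
      "1 - R * (c * d) = (R - 1) * (R - g ^ (k + l)) / ((R - g ^ k) * (R - g ^ l))"
      unfolding c_def d_def power_add by (rule parallel_law_radius[OF bk(2) bl(2)])+
    have cd: "0 \<le> c" "0 \<le> d" using bk bl by (auto simp: c_def d_def)
    have tu: "cmod (t * u) \<le> c * d"
      unfolding norm_mult c_def d_def using 3 cd by (intro mult_mono) (auto simp: c_def)
    have "cmod (q - 2) \<le> R + 1"
      using norm_triangle_ineq4[of "q - 1" 1] by (simp add: R_def)
    then have "cmod ((q - 2) * (t * u)) \<le> (R + 1) * (c * d)"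
      unfolding norm_mult[of "q - 2"] using tu R_gt_2 by (intro mult_mono) auto
    then have num: "cmod (t + u + (q - 2) * (t * u)) \<le> c + d + (R + 1) * (c * d)"
      using 3 norm_triangle_ineq[of "t + u" "(q - 2) * (t * u)"] norm_triangle_ineq[of t u]
      unfolding c_def d_def by linarith
    have "cmod ((q - 1) * (t * u)) \<le> R * (c * d)"
      unfolding norm_mult[of "q - 1"] R_def[symmetric] using tu R_gt_2 by (intro mult_left_mono) auto
    then have den: "1 - R * (c * d) \<le> cmod (1 + (q - 1) * (t * u))"
      using norm_triangle_ineq4[of "1 + (q - 1) * (t * u)" "(q - 1) * (t * u)"] by simp
    \<comment> \<open>By the law this amounts to \<open>g ^ (k + l) < R\<close>, which is where
      \<open>k + l < L\<close> enters.\<close>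
    have pos: "0 < 1 - R * (c * d)" unfolding law(2) using bk bl bkl R_gt_2 by simp
    have "cmod ((t + u + (q - 2) * (t * u)) / (1 + (q - 1) * (t * u))) \<le>
        (c + d + (R + 1) * (c * d)) / (1 - R * (c * d))"
      unfolding norm_divide using order_trans[OF norm_ge_zero num] num pos den by (rule frac_le)
    also have "\<dots> = (g ^ (k + l) - 1) / (R - g ^ (k + l))"
      unfolding law using bk bl bkl R_gt_2 by simp
    finally show ?thesis by (simp add: disc_def)
  qed
qed

text \<open>The worst case is \<open>cmod (q - 2) = R - 1\<close>, and there the choice of
  \<open>g\<close> gives equality.\<close>

lemma wheatstone_in_disc: "2 / ((q - 1) * (q - 2)) \<in> disc 2"
proof -
  have "R - 1 \<le> cmod (q - 2)"
    using norm_triangle_ineq2[of "q - 1" 1] by (simp add: R_def)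
  then have "cmod (2 / ((q - 1) * (q - 2))) \<le> 2 / (R * (R - 1))"
    unfolding norm_divide norm_mult R_def[symmetric] using R_gt_2
    by (intro frac_le mult_mono) auto
  also have "\<dots> = (g\<^sup>2 - 1) / (R - g\<^sup>2)"
  proof -
    have "g\<^sup>2 - 1 = 2 * (R - 1) / (R\<^sup>2 - R + 2)"
      using denom_pos unfolding g_sq by (simp add: field_simps power2_eq_square)
    moreover have "R - g\<^sup>2 = R * (R - 1)\<^sup>2 / (R\<^sup>2 - R + 2)"
      using denom_pos unfolding g_sq by (simp add: field_simps power2_eq_square)
    ultimately have "(g\<^sup>2 - 1) / (R - g\<^sup>2) = 2 * (R - 1) / (R * (R - 1)\<^sup>2)"
      using denom_pos by simp
    also have "\<dots> = 2 / (R * (R - 1))"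
      unfolding power2_eq_square mult.assoc[symmetric]
      using R_gt_2 by (intro mult_divide_mult_cancel_right) simp
    finally show ?thesis by simp
  qed
  finally show ?thesis by (simp add: disc_def)
qed

end

section \<open>Induction over the class\<close>

context outside_disc
begin

text \<open>A graph with a
  large flow between its terminals is harmless as long as nothing is connected in parallel to it,
  hence the first, weaker clause.\<close>

definition controlled :: "tgraph \<Rightarrow> bool" where
  "controlled G \<longleftrightarrow> wf_tgraph G \<and> (\<exists>k\<ge>1. linked G k \<and>
     (flow_bounded G {} L \<longrightarrow> chrom_poly G q \<noteq> 0) \<and>
     (flow_bounded G (terminal_link G) L \<longrightarrow>
        chrom_poly G q \<noteq> 0 \<and> conn_poly G q / chrom_poly G q \<in> disc k))"

lemma q_nonzero: "q \<noteq> 0" "q \<noteq> 1" "q \<noteq> 2"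
  using R_gt_2 by (auto simp: R_def)

lemma controlled_K2: "controlled K2"
proof -
  have "conn_poly K2 q / chrom_poly K2 q = - 1 / (q - 1)"
    using q_nonzero by (simp add: conn_poly_K2 chrom_poly_K2)
  then show ?thesis
    unfolding controlled_def using wf_K2 linked_K2 q_nonzero
    by (intro conjI exI[of _ 1]) (auto simp: chrom_poly_K2 disc_def)
qed

lemma controlled_wheatstone: "controlled wheatstone"
proof -
  have "conn_poly wheatstone q / chrom_poly wheatstone q = 2 / ((q - 1) * (q - 2))"
    using q_nonzero unfolding conn_poly_wheatstone chrom_poly_wheatstone
    by (simp add: divide_simps power2_eq_square)
  then show ?thesis
    unfolding controlled_def using wf_wheatstone linked_wheatstone q_nonzero wheatstone_in_disc
    by (intro conjI exI[of _ 2]) (auto simp: chrom_poly_wheatstone)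
qed

lemma controlled_iso:
  assumes "controlled G" "tg_iso G H"
  shows "controlled H"
proof -
  have "wf_tgraph G" using assms(1) by (simp add: controlled_def)
  moreover obtain f g where "bij_betw f (verts G) (verts H)" "bij_betw g (edges G) (edges H)"
    "\<forall>e\<in>edges G. inc H (g e) = f ` inc G e" "f (src G) = src H" "f (tgt G) = tgt H"
    using assms(2) unfolding tg_iso_def by blast
  ultimately interpret tgraph_isomorphism G H f g by unfold_locales auto
  from assms(1) obtain k where "k \<ge> 1" "linked G k"
    "flow_bounded G {} L \<longrightarrow> chrom_poly G q \<noteq> 0"
    "flow_bounded G (terminal_link G) L \<longrightarrow>
      chrom_poly G q \<noteq> 0 \<and> conn_poly G q / chrom_poly G q \<in> disc k"
    unfolding controlled_def by blast
  then show ?thesis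
    unfolding controlled_def using wf_H linked_H flow_bounded_G
    by (intro conjI exI[of _ k]) (auto simp: chrom_poly_H conn_poly_H)
qed

end

locale controlled_pair = outside_disc + disjoint_tgraphs +
  assumes controlled1: "controlled G1" and controlled2: "controlled G2"
begin

abbreviation "t1 \<equiv> conn_poly G1 q / chrom_poly G1 q"
abbreviation "t2 \<equiv> conn_poly G2 q / chrom_poly G2 q"

lemma controlled_par: "controlled (par_comp G1 G2)"
proof -
  let ?P = "par_comp G1 G2"
  from controlled1 obtain k where k: "k \<ge> 1" "linked G1 k"
    and c1: "flow_bounded G1 (terminal_link G1) L \<Longrightarrow> chrom_poly G1 q \<noteq> 0 \<and> t1 \<in> disc k"
    unfolding controlled_def by blast
  from controlled2 obtain l where l: "l \<ge> 1" "linked G2 l"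
    and c2: "flow_bounded G2 (terminal_link G2) L \<Longrightarrow> chrom_poly G2 q \<noteq> 0 \<and> t2 \<in> disc l"
    unfolding controlled_def by blast
  have main: "chrom_poly ?P q \<noteq> 0" "conn_poly ?P q / chrom_poly ?P q =
      (t1 + t2 + (q - 2) * (t1 * t2)) / (1 + (q - 1) * (t1 * t2))"
    if fb: "flow_bounded G1 (terminal_link G1) L" "flow_bounded G2 (terminal_link G2) L"
  proof -
    let ?Z = "chrom_poly G1 q * chrom_poly G2 q"
    have Z: "?Z \<noteq> 0" using c1 c2 fb by simp
    have "k < L" "l < L"
      using linked_flow_bounded[OF wf1 k(2) fb(1)] linked_flow_bounded[OF wf2 l(2) fb(2)] by auto
    then have den: "1 + (q - 1) * (t1 * t2) \<noteq> 0" using mult_disc_denom c1 c2 fb by blast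
    have 1: "q\<^sup>2 * chrom_poly ?P q = ?Z * (1 + (q - 1) * (t1 * t2))"
      unfolding chrom_poly_par using Z by (simp add: distrib_left)
    have 2: "q\<^sup>2 * conn_poly ?P q = ?Z * (t1 + t2 + (q - 2) * (t1 * t2))"
      unfolding conn_poly_par using Z by (simp add: distrib_left)
    show "chrom_poly ?P q \<noteq> 0" using 1 Z den by auto
    have "conn_poly ?P q / chrom_poly ?P q = (q\<^sup>2 * conn_poly ?P q) / (q\<^sup>2 * chrom_poly ?P q)"
      using q_nonzero by simp
    also have "\<dots> = (t1 + t2 + (q - 2) * (t1 * t2)) / (1 + (q - 1) * (t1 * t2))"
      unfolding 1 2 using Z by (rule mult_divide_mult_cancel_left)
    finally show "conn_poly ?P q / chrom_poly ?P q =
      (t1 + t2 + (q - 2) * (t1 * t2)) / (1 + (q - 1) * (t1 * t2))" .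
  qed
  have linked: "linked ?P (k + l)" using k(2) l(2) by (rule linked_par)
  \<comment> \<open>Without an outside link, \<open>k + l\<close> may reach \<open>L\<close>. The
    denominator only needs \<open>k < L\<close> and \<open>l < L\<close>, which hold because each
    factor has the other in parallel.\<close>
  have "chrom_poly ?P q \<noteq> 0" if "flow_bounded ?P {} L"
    using flow_bounded_par[OF that] linked_joined_edges[OF k(2,1)] linked_joined_edges[OF l(2,1)] main(1)
    by blast
  moreover have "chrom_poly ?P q \<noteq> 0 \<and> conn_poly ?P q / chrom_poly ?P q \<in> disc (k + l)"
    if fb: "flow_bounded ?P (terminal_link ?P) L"
  proof -
    note fb12 = flow_bounded_par_link[OF fb]
    have "k + l < L" by (rule linked_flow_bounded[OF wf_par_comp linked fb])
    then have "(t1 + t2 + (q - 2) * (t1 * t2)) / (1 + (q - 1) * (t1 * t2)) \<in> disc (k + l)"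
      using parallel_in_disc c1 c2 fb12 by blast
    then show ?thesis using main[OF fb12] by simp
  qed
  ultimately show ?thesis
    unfolding controlled_def using wf_par_comp linked k(1) by (intro conjI exI[of _ "k + l"]) auto
qed

lemma controlled_ser: "controlled (ser_comp G1 G2)"
proof -
  let ?S = "ser_comp G1 G2"
  from controlled1 obtain k where k: "k \<ge> 1" "linked G1 k"
    and n1: "flow_bounded G1 {} L \<Longrightarrow> chrom_poly G1 q \<noteq> 0"
    and c1: "flow_bounded G1 (terminal_link G1) L \<Longrightarrow> chrom_poly G1 q \<noteq> 0 \<and> t1 \<in> disc k"
    unfolding controlled_def by blast
  from controlled2 obtain l where l: "l \<ge> 1" "linked G2 l"
    and n2: "flow_bounded G2 {} L \<Longrightarrow> chrom_poly G2 q \<noteq> 0"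
    and c2: "flow_bounded G2 (terminal_link G2) L \<Longrightarrow> chrom_poly G2 q \<noteq> 0 \<and> t2 \<in> disc l"
    unfolding controlled_def by blast
  have linked: "linked ?S (min k l)" using k(2) l(2) by (rule linked_ser)
  have nonzero: "chrom_poly ?S q \<noteq> 0" if "chrom_poly G1 q \<noteq> 0" "chrom_poly G2 q \<noteq> 0"
    using chrom_poly_ser[of q] that by auto
  \<comment> \<open>With nothing outside, the factors have nothing in parallel to them either, so
    their weak clauses must suffice; they do, as the polynomials multiply.\<close>
  have "chrom_poly ?S q \<noteq> 0" if "flow_bounded ?S {} L"
    using flow_bounded_ser[OF that] n1 n2 nonzero by blast
  moreover have "chrom_poly ?S q \<noteq> 0 \<and> conn_poly ?S q / chrom_poly ?S q \<in> disc (min k l)"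
    if fb: "flow_bounded ?S (terminal_link ?S) L"
  proof -
    have fb12: "flow_bounded G1 (terminal_link G1) L" "flow_bounded G2 (terminal_link G2) L"
      using flow_bounded_ser_link[OF fb] linked_joined_edges[OF k(2,1)] linked_joined_edges[OF l(2,1)]
      by blast+
    have "k < L" "l < L"
      using linked_flow_bounded[OF wf1 k(2) fb12(1)] linked_flow_bounded[OF wf2 l(2) fb12(2)] by auto
    then have "t1 * t2 \<in> disc (min k l)"
      using c1 c2 fb12 k(1) l(1) by (intro mult_in_disc[of k l]) auto
    moreover have "conn_poly ?S q / chrom_poly ?S q = (q * conn_poly ?S q) / (q * chrom_poly ?S q)"
      using q_nonzero by simp
    then have "conn_poly ?S q / chrom_poly ?S q = t1 * t2"
      unfolding conn_poly_ser chrom_poly_ser by simp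
    ultimately show ?thesis using nonzero c1 c2 fb12 by simp
  qed
  ultimately show ?thesis
    unfolding controlled_def using wf_ser_comp linked k(1) l(1)
    by (intro conjI exI[of _ "min k l"]) auto
qed

end

lemma (in outside_disc) controlled_classW:
  assumes "G \<in> classW"
  shows "controlled G"
  using assms
proof induction
  case K2
  show ?case by (rule controlled_K2)
next
  case wheat
  show ?case by (rule controlled_wheatstone)
next
  case (iso G H)
  from iso.IH iso.hyps(2) show ?case by (rule controlled_iso)
next
  case (par G1 G2)
  interpret controlled_pair q L G1 G2
    by unfold_locales (use par in \<open>auto simp: controlled_def\<close>)
  show ?case by (rule controlled_par)
next
  case (ser G1 G2)
  interpret controlled_pair q L G1 G2
    by unfold_locales (use ser in \<open>auto simp: controlled_def\<close>)
  show ?case by (rule controlled_ser)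
qed

theorem theorem1p6:
  fixes G :: tgraph and L :: nat and q :: complex
  assumes "L \<ge> 3"
    and "G \<in> classW"
    and "maxmaxflow G \<le> L"
    and "chrom_poly G q = 0"
  shows "cmod (q - 1) < (real L - ln 2) / ln 2"
proof (rule ccontr)
  assume "\<not> ?thesis"
  then interpret outside_disc q L using assms(1) by unfold_locales auto
  have "controlled G" using assms(2) by (rule controlled_classW)
  moreover from this have "flow_bounded G {} L"
    using assms(3) by (intro flow_bounded_maxmaxflow) (simp_all add: controlled_def)
  ultimately show False using assms(4) unfolding controlled_def by blast
qed

end
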